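(* Let $T=(V,E)$ be a finite tree whose edges carry real (symmetric) positive definite $s\times s$ matrix weights. If there exists a vertex $v$ in $T$ such that there are two or more Perron branches at $v$, then $v$ is the unique vertex with this property. Moreover, if $x$ is a vertex other than $v$, then there is a unique Perron branch at $x$ in $T$, and it is the branch which contains the vertex $v$.
   Context: Laplacian: for a tree $T=(V,E)$ on $n$ vertices with $s\times s$ matrix edge weights $W(e)$, $L=[l_{uv}]_{u,v\in V}$ is the $ns\times ns$ block matrix whose $s\times s$ blocks are: for $u\ne v$, $l_{uv}=-W(e)$ if $u,v$ are joined by the edge $e$, and $l_{uv}=\mathbf 0$ if $u,v$ are not adjacent; $l_{vv}$ is the sum of the weights of the edges incident with $v$. For $v\in V$, $L_v$ is $L$ with the row block and column block of $v$ deleted; it is invertible, and $M_v=L_v^{-1}$. A branch at $v$ is a connected component of the graph obtained from $T$ by deleting $v$ and its incident edges. $M_v$ is block diagonal with one diagonal block $M_v(B)$ (bottleneck matrix) for each branch $B$ at $v$; for $x,y\in B$ the $(x,y)$ block of $M_v(B)$ is $\sum_{e\in \mathcal P(x,v)\cap\mathcal P(y,v)}W(e)^{-1}$, where $\mathcal P(a,b)$ is the path joining $a$ and $b$. Write $\rho(\cdot)$ for spectral radius. A branch $B$ at $v$ is a Perron branch at $v$ if $\rho(M_v(B))=\rho(M_v)$, equivalently if $\rho(M_v(B))$ is the largest among all branches at $v$. *)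

theory Defs
  imports
    "Graph_Theory.Graph_Theory"
    "Jordan_Normal_Form.Spectral_Radius"
    "Jordan_Normal_Form.Gauss_Jordan_Elimination"
    "Jordan_Normal_Form.DL_Submatrix"
begin

text \<open>
  A finite simple graph is a \<^locale>\<open>pair_graph\<close>: a finite loop-free symmetric digraph, where
  the edge joining \<open>u\<close> and \<open>w\<close> is the pair of arcs \<open>(u, w)\<close>, \<open>(w, u)\<close>. An edge traversed back
  and forth is a \<^const>\<open>pre_digraph.cycle\<close> of length 2, so acyclicity of the undirected graph is
  the absence of cycles of length at least 3. (The library constant \<open>Digraph_Component.tree\<close>
  is about directed cycles and is not the notion needed here.)
\<close>

definition undirected_tree :: "'a pair_pre_digraph \<Rightarrow> bool" where
  "undirected_tree T \<longleftrightarrow>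
     pair_graph T \<and> Digraph_Component.connected (with_proj T) \<and>
     \<not> (\<exists>p. pre_digraph.cycle (with_proj T) p \<and> 3 \<le> length p)"

text \<open>
  Components are given by their vertex sets; strong connectedness is connectedness
  because the digraph is symmetric.
\<close>

definition branches :: "'a pair_pre_digraph \<Rightarrow> 'a \<Rightarrow> 'a set set" where
  "branches T v = pre_digraph.sccs_verts (pre_digraph.del_vert (with_proj T) v)"

definition pos_def_mat :: "nat \<Rightarrow> real mat \<Rightarrow> bool" where
  "pos_def_mat s A \<longleftrightarrow>
     A \<in> carrier_mat s s \<and> transpose_mat A = A \<and>
     (\<forall>x \<in> carrier_vec s. x \<noteq> 0\<^sub>v s \<longrightarrow> 0 < x \<bullet> (A *\<^sub>v x))"

text \<open>
  A list \<open>vs\<close> of vertices fixes the order of the row and column blocks: for \<open>k < s\<close>, row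
  \<open>m * s + k\<close> is row \<open>k\<close> of the block row of the vertex \<open>vs ! m\<close>. The weight of the edge
  joining \<open>u\<close> and \<open>w\<close> is \<open>W {u, w}\<close>.
\<close>

definition laplacian_block ::
  "'a pair_pre_digraph \<Rightarrow> nat \<Rightarrow> ('a set \<Rightarrow> real mat) \<Rightarrow> 'a \<Rightarrow> 'a \<Rightarrow> real mat" where
  "laplacian_block T s W u w =
     (if u = w then mat s s (\<lambda>(k, l). \<Sum>x | (u, x) \<in> parcs T. W {u, x} $$ (k, l))
      else if (u, w) \<in> parcs T then - W {u, w}
      else 0\<^sub>m s s)"

definition laplacian ::
  "'a pair_pre_digraph \<Rightarrow> nat \<Rightarrow> ('a set \<Rightarrow> real mat) \<Rightarrow> 'a list \<Rightarrow> real mat" where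
  "laplacian T s W vs =
     mat (length vs * s) (length vs * s)
       (\<lambda>(i, j). laplacian_block T s W (vs ! (i div s)) (vs ! (j div s)) $$ (i mod s, j mod s))"

text \<open>
  The principal submatrix of \<open>A\<close> on the blocks of the vertices in \<open>S\<close>, where the blocks
  of \<open>A\<close> are ordered by the list \<open>xs\<close>.
\<close>

definition principal_blocks :: "nat \<Rightarrow> 'a list \<Rightarrow> 'a set \<Rightarrow> 'b mat \<Rightarrow> 'b mat" where
  "principal_blocks s xs S A =
     (let I = {i. i < length xs * s \<and> xs ! (i div s) \<in> S} in submatrix A I I)"

definition reduced_laplacian ::
  "'a pair_pre_digraph \<Rightarrow> nat \<Rightarrow> ('a set \<Rightarrow> real mat) \<Rightarrow> 'a list \<Rightarrow> 'a \<Rightarrow> real mat" where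
  "reduced_laplacian T s W vs v = principal_blocks s vs (- {v}) (laplacian T s W vs)"

text \<open>
  The reduced Laplacian of a tree with positive definite weights is invertible, so
  \<^const>\<open>the\<close> is applied to its actual inverse.
\<close>

definition bottleneck ::
  "'a pair_pre_digraph \<Rightarrow> nat \<Rightarrow> ('a set \<Rightarrow> real mat) \<Rightarrow> 'a list \<Rightarrow> 'a \<Rightarrow> real mat" where
  "bottleneck T s W vs v = the (mat_inverse (reduced_laplacian T s W vs v))"

text \<open>
  The diagonal block of \<^const>\<open>bottleneck\<close> belonging to the branch \<open>B\<close>. After the deletion
  of \<open>v\<close>, the blocks are ordered by the remaining vertices of \<open>vs\<close>.
\<close>

definition bottleneck_branch ::
  "'a pair_pre_digraph \<Rightarrow> nat \<Rightarrow> ('a set \<Rightarrow> real mat) \<Rightarrow> 'a list \<Rightarrow> 'a \<Rightarrow> 'a set \<Rightarrow> real mat" where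
  "bottleneck_branch T s W vs v B =
     principal_blocks s (filter (\<lambda>x. x \<noteq> v) vs) B (bottleneck T s W vs v)"

definition real_spectral_radius :: "real mat \<Rightarrow> real" where
  "real_spectral_radius A = spectral_radius (map_mat complex_of_real A)"

definition perron_branches ::
  "'a pair_pre_digraph \<Rightarrow> nat \<Rightarrow> ('a set \<Rightarrow> real mat) \<Rightarrow> 'a list \<Rightarrow> 'a \<Rightarrow> 'a set set" where
  "perron_branches T s W vs v =
     {B \<in> branches T v. real_spectral_radius (bottleneck_branch T s W vs v B)
                        = real_spectral_radius (bottleneck T s W vs v)}"

end

theory Submission
  imports Defs "HOL-Analysis.Function_Topology"
begin

text \<open>
  The bottleneck matrix of a branch \<open>B\<close> at \<open>x\<close> is the inverse of the principal block \<open>L[B]\<close> of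
  the Laplacian, because \<open>L\<close> has no entries between \<open>B\<close> and the other branches at \<open>x\<close>. Its
  spectral radius is therefore the reciprocal of the least eigenvalue of \<open>L[B]\<close>, in other words
  the best constant \<open>\<mu>\<close> in \<open>|f|\<^sup>2 \<le> \<mu> (f \<bullet> L f)\<close> for vectors \<open>f\<close> supported on \<open>B\<close>; the whole
  bottleneck matrix at \<open>x\<close> gives the best constant for vectors that vanish at \<open>x\<close>. In this form
  the constants for different vertices can be compared: they grow with the supporting set
  (\<open>optimal_bound_mono\<close>).

  Let \<open>v\<close> have two Perron branches and let \<open>x \<noteq> v\<close>. One of the two, say \<open>B\<close>, does not contain \<open>x\<close>,
  so \<open>B\<close> and \<open>v\<close> both lie in the branch \<open>C\<close> at \<open>x\<close> that contains \<open>v\<close>. Every other branch \<open>D\<close> at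
  \<open>x\<close> misses \<open>v\<close>, hence its constant is at most that of \<open>V - {v}\<close>, which is the constant of \<open>B\<close>
  because \<open>B\<close> is Perron. So it suffices that the constant of \<open>C\<close> strictly exceeds that of \<open>B\<close>:
  then no \<open>D\<close> is Perron at \<open>x\<close>, and \<open>C\<close> is, since some branch must be (\<open>perron_branch_exists\<close>).

  Strictness (\<open>optimal_bound_strict_mono\<close>) is a unique continuation argument. If the two constants
  agreed, an extremal vector for \<open>B\<close>, extended by zero, would be extremal for \<open>C\<close> and vanish at
  \<open>v \<in> C\<close>. But zeros of extremal vectors spread to neighbours (\<open>extremal_zero_propagates\<close>). Indeed,
  where \<open>f\<close> vanishes at \<open>a\<close>, it is a sum of pieces on the branches at \<open>a\<close> which do not interact, so
  that each piece is extremal again and satisfies the eigenvalue equation. Each branch at \<open>a\<close>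
  contains one neighbour \<open>w\<close> of \<open>a\<close> only, so row \<open>a\<close> of that equation reads \<open>W(a,w) f(w) = 0\<close>, and
  \<open>W(a,w)\<close> is invertible. As \<open>C\<close> is connected, the extremal vector would be zero.
\<close>

section \<open>Optimal bounds for quadratic forms\<close>

definition quad_form :: "('i \<Rightarrow> 'i \<Rightarrow> real) \<Rightarrow> 'i set \<Rightarrow> ('i \<Rightarrow> real) \<Rightarrow> ('i \<Rightarrow> real) \<Rightarrow> real" where
  "quad_form k J f g = (\<Sum>p\<in>J. \<Sum>q\<in>J. f p * k p q * g q)"

definition pos_def_on :: "('i \<Rightarrow> 'i \<Rightarrow> real) \<Rightarrow> 'i set \<Rightarrow> bool" where
  "pos_def_on k J \<longleftrightarrow> (\<forall>f. (\<exists>p\<in>J. f p \<noteq> 0) \<longrightarrow> 0 < quad_form k J f f)"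

text \<open>
  For a symmetric positive definite kernel this \<open>\<mu>\<close> is the reciprocal of the least eigenvalue.
  The equality case is part of the definition because everything below works with extremal
  vectors, those attaining the bound.
\<close>

definition optimal_bound :: "('i \<Rightarrow> 'i \<Rightarrow> real) \<Rightarrow> 'i set \<Rightarrow> real \<Rightarrow> bool" where
  "optimal_bound k J \<mu> \<longleftrightarrow> 0 < \<mu> \<and> (\<forall>f. (\<Sum>p\<in>J. (f p)\<^sup>2) \<le> \<mu> * quad_form k J f f) \<and>
     (\<exists>f. (\<exists>p\<in>J. f p \<noteq> 0) \<and> (\<Sum>p\<in>J. (f p)\<^sup>2) = \<mu> * quad_form k J f f)"

lemma quad_form_scale: "quad_form k J (\<lambda>p. c * f p) (\<lambda>p. c * f p) = c\<^sup>2 * quad_form k J f f"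
  by (simp add: quad_form_def sum_distrib_left power2_eq_square mult_ac)

lemma quad_form_add_scaled:
  assumes "\<And>p q. p \<in> J \<Longrightarrow> q \<in> J \<Longrightarrow> k p q = k q p"
  shows "quad_form k J (\<lambda>p. f p + t * h p) (\<lambda>p. f p + t * h p)
    = quad_form k J f f + 2 * t * quad_form k J h f + t\<^sup>2 * quad_form k J h h"
proof -
  have swap: "quad_form k J f h = quad_form k J h f"
    unfolding quad_form_def by (subst sum.swap) (auto intro!: sum.cong simp: assms)
  have add_left: "quad_form k J (\<lambda>p. f p + t * h p) g = quad_form k J f g + t * quad_form k J h g" for g
    by (simp add: quad_form_def distrib_right sum.distrib sum_distrib_left mult.assoc)
  have add_right: "quad_form k J g (\<lambda>p. f p + t * h p) = quad_form k J g f + t * quad_form k J g h" for g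
    by (simp add: quad_form_def distrib_left sum.distrib sum_distrib_left mult_ac)
  show ?thesis
    by (simp add: add_left add_right swap power2_eq_square algebra_simps)
qed

lemma quad_form_extend_by_zero:
  assumes "finite J'" "J \<subseteq> J'"
  shows "quad_form k J' (\<lambda>p. if p \<in> J then f p else 0) (\<lambda>p. if p \<in> J then f p else 0)
    = quad_form k J f f"
proof -
  have "(\<Sum>q\<in>J'. (if p \<in> J then f p else 0) * k p q * (if q \<in> J then f q else 0))
     = (\<Sum>q\<in>J. (if p \<in> J then f p else 0) * k p q * f q)" for p
    by (rule sum.mono_neutral_cong_right) (use assms in auto)
  then show ?thesis
    unfolding quad_form_def using assms by (simp) (rule sum.mono_neutral_cong_right, auto)
qed

lemma sum_squares_extend_by_zero:
  assumes "finite J'" "J \<subseteq> J'"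
  shows "(\<Sum>p\<in>J'. (if p \<in> J then f p else (0::real))\<^sup>2) = (\<Sum>p\<in>J. (f p)\<^sup>2)"
  by (rule sum.mono_neutral_cong_right) (use assms in auto)

lemma optimal_bound_pos: "optimal_bound k J \<mu> \<Longrightarrow> 0 < \<mu>"
  and optimal_boundD: "optimal_bound k J \<mu> \<Longrightarrow> (\<Sum>p\<in>J. (f p)\<^sup>2) \<le> \<mu> * quad_form k J f f"
  by (auto simp: optimal_bound_def)

lemma optimal_bound_le:
  assumes opt: "optimal_bound k J \<mu>" and pd: "pos_def_on k J"
    and "\<exists>p\<in>J. f p \<noteq> 0" and "\<nu> * quad_form k J f f \<le> (\<Sum>p\<in>J. (f p)\<^sup>2)"
  shows "\<nu> \<le> \<mu>"
proof -
  have "0 < quad_form k J f f" using pd assms(3) by (auto simp: pos_def_on_def)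
  moreover have "\<nu> * quad_form k J f f \<le> \<mu> * quad_form k J f f"
    using optimal_boundD[OF opt, of f] assms(4) by linarith
  ultimately show ?thesis by simp
qed

text \<open>
  Extension by zero turns an extremal vector on the smaller index set into a competitor on the
  larger one.
\<close>

lemma optimal_bound_mono:
  assumes "optimal_bound k J \<mu>" "optimal_bound k J' \<mu>'" "J \<subseteq> J'" "finite J'" "pos_def_on k J'"
  shows "\<mu> \<le> \<mu>'"
proof -
  obtain f where f: "\<exists>p\<in>J. f p \<noteq> 0" "(\<Sum>p\<in>J. (f p)\<^sup>2) = \<mu> * quad_form k J f f"
    using assms(1) by (auto simp: optimal_bound_def)
  show ?thesis
  proof (rule optimal_bound_le[OF assms(2,5), where f = "\<lambda>p. if p \<in> J then f p else 0"])
    show "\<exists>p\<in>J'. (if p \<in> J then f p else 0) \<noteq> 0" using f(1) assms(3) by auto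
  qed (simp only: quad_form_extend_by_zero[OF assms(4,3)] sum_squares_extend_by_zero[OF assms(4,3)] f(2) order.refl)
qed

text \<open>
  The Rayleigh quotient attains its minimum on the unit sphere. Since the index set is arbitrary,
  the sphere is taken inside the product topology on functions, where the cube \<open>B\<close> is compact by
  Tychonoff's theorem; the value \<open>undefined\<close> outside \<open>J\<close> makes the cube a \<open>PiE\<close> product.
\<close>

lemma optimal_bound_exists:
  assumes fin: "finite J" and "J \<noteq> {}" and pd: "pos_def_on k J"
  shows "\<exists>\<mu>. optimal_bound k J \<mu>"
proof -
  let ?nrm = "\<lambda>f :: 'a \<Rightarrow> real. \<Sum>p\<in>J. (f p)\<^sup>2"
  define B where "B = PiE J (\<lambda>_. {-1..1::real})"
  define K where "K = B \<inter> {f. ?nrm f = 1}"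
  have "compactin (product_topology (\<lambda>_. euclidean) UNIV) (PiE UNIV (\<lambda>p. if p \<in> J then {-1..1::real} else {undefined}))"
    by (subst compactin_PiE) auto
  moreover have "PiE UNIV (\<lambda>p. if p \<in> J then {-1..1::real} else {undefined}) = B"
    by (auto simp: B_def PiE_def extensional_def Pi_def split: if_splits)
  ultimately have compB: "compact B"
    by (simp add: euclidean_product_topology)
  have cont_coord: "continuous_on UNIV (\<lambda>f :: 'a \<Rightarrow> real. f p)" for p
    by simp
  have cont_nrm: "continuous_on UNIV ?nrm"
    by (intro continuous_intros cont_coord)
  have cont_quad: "continuous_on UNIV (\<lambda>f. quad_form k J f f)"
    unfolding quad_form_def by (intro continuous_intros cont_coord)
  have "closed {f. ?nrm f = 1}"
    by (rule closed_Collect_eq[OF cont_nrm continuous_on_const])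
  then have compK: "compact K"
    unfolding K_def using compB by (simp add: compact_Int_closed)
  have unit_in_K: "(\<lambda>p. if p \<in> J then f p else undefined) \<in> K" if "?nrm f = 1" for f
  proof -
    have "(f p)\<^sup>2 \<le> 1" if "p \<in> J" for p
      using member_le_sum[OF that, of "\<lambda>p. (f p)\<^sup>2"] fin \<open>?nrm f = 1\<close> by simp
    then have "-1 \<le> f p \<and> f p \<le> 1" if "p \<in> J" for p
      using that by (auto simp: abs_square_le_1 abs_le_iff)
    moreover have "?nrm (\<lambda>p. if p \<in> J then f p else undefined) = ?nrm f"
      by (rule sum.cong) auto
    ultimately show ?thesis using that by (auto simp: K_def B_def)
  qed
  have quad_restrict: "quad_form k J (\<lambda>p. if p \<in> J then f p else undefined) (\<lambda>p. if p \<in> J then f p else undefined)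
      = quad_form k J f f" for f
    by (auto simp: quad_form_def intro!: sum.cong)
  obtain p0 where p0: "p0 \<in> J" using \<open>J \<noteq> {}\<close> by auto
  have "?nrm (\<lambda>p. if p = p0 then 1 else 0) = 1"
    using fin p0 by (simp add: if_distrib[of "\<lambda>x. x\<^sup>2"] cong: if_cong)
  from unit_in_K[OF this] have "K \<noteq> {}" by blast
  then obtain f0 where f0: "f0 \<in> K" "\<And>f. f \<in> K \<Longrightarrow> quad_form k J f0 f0 \<le> quad_form k J f f"
    using continuous_attains_inf[OF compK] continuous_on_subset[OF cont_quad subset_UNIV] by blast
  define l0 where "l0 = quad_form k J f0 f0"
  have nrm0: "?nrm f0 = 1" using f0(1) by (simp add: K_def)
  have nz0: "\<exists>p\<in>J. f0 p \<noteq> 0"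
    using nrm0 by (metis (no_types, lifting) power_zero_numeral sum.neutral zero_neq_one)
  then have "0 < l0" using pd by (simp add: l0_def pos_def_on_def)
  have "?nrm f \<le> 1 / l0 * quad_form k J f f" for f
  proof (cases "\<exists>p\<in>J. f p \<noteq> 0")
    case False
    then show ?thesis by (simp add: quad_form_def)
  next
    case True
    have pos: "0 < ?nrm f"
      using True fin by (meson sum_pos2 zero_le_power2 zero_less_power2)
    define c where "c = 1 / sqrt (?nrm f)"
    have c2: "c\<^sup>2 = 1 / ?nrm f" using pos by (simp add: c_def power_divide)
    have "?nrm (\<lambda>p. c * f p) = c\<^sup>2 * ?nrm f"
      by (simp add: power_mult_distrib sum_distrib_left)
    then have "?nrm (\<lambda>p. c * f p) = 1" using pos c2 by simp
    from f0(2)[OF unit_in_K[OF this]]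
    have "l0 \<le> quad_form k J (\<lambda>p. c * f p) (\<lambda>p. c * f p)"
      unfolding quad_restrict[of "\<lambda>p. c * f p"] l0_def .
    then have "l0 \<le> quad_form k J f f / ?nrm f"
      by (simp add: quad_form_scale c2)
    then show ?thesis using pos \<open>0 < l0\<close> by (simp add: field_simps)
  qed
  moreover have "?nrm f0 = 1 / l0 * quad_form k J f0 f0"
    using nrm0 \<open>0 < l0\<close> by (simp add: l0_def)
  ultimately have "optimal_bound k J (1 / l0)"
    using nz0 \<open>0 < l0\<close> by (auto simp: optimal_bound_def)
  then show ?thesis by blast
qed

text \<open>
  The first-order condition at a minimum, for a quadratic function of one variable with value
  \<open>0\<close> there.
\<close>

lemma nonneg_quadratic_linear_coeff_zero:
  fixes b c :: real
  assumes "\<And>t. 0 \<le> 2 * t * b + t\<^sup>2 * c"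
  shows "b = 0"
proof (rule ccontr)
  assume "b \<noteq> 0"
  define d where "d = \<bar>c\<bar> + 1"
  have "d > 0" "c < d" by (auto simp: d_def)
  \<comment> \<open>For \<open>c > 0\<close> the minimum of the quadratic lies at \<open>- b / c\<close>; replacing \<open>c\<close> by a positive upper bound avoids
    a case distinction on the sign of \<open>c\<close>.\<close>
  have "0 \<le> 2 * (- b / d) * b + (- b / d)\<^sup>2 * c" by (rule assms)
  also have "\<dots> = (b / d)\<^sup>2 * (c - 2 * d)"
    using \<open>d > 0\<close> by (simp add: field_simps power2_eq_square)
  also have "\<dots> < 0"
    using \<open>b \<noteq> 0\<close> \<open>d > 0\<close> \<open>c < d\<close> by (intro mult_pos_neg) auto
  finally show False by simp
qed

text \<open>
  An extremal vector minimizes \<open>\<mu> (f \<bullet> k f) - |f|\<^sup>2\<close>, so the derivative in the direction of each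
  unit vector vanishes.
\<close>

lemma extremal_imp_eigen:
  assumes fin: "finite J" and sym: "\<And>p q. p \<in> J \<Longrightarrow> q \<in> J \<Longrightarrow> k p q = k q p"
    and bound: "optimal_bound k J \<mu>"
    and extremal: "(\<Sum>p\<in>J. (f p)\<^sup>2) = \<mu> * quad_form k J f f"
    and p: "p \<in> J"
  shows "\<mu> * (\<Sum>q\<in>J. k p q * f q) = f p"
proof -
  define h where "h = (\<lambda>q. if q = p then 1 else (0::real))"
  have kh: "quad_form k J h g = (\<Sum>q\<in>J. k p q * g q)" for g
  proof -
    have "quad_form k J h g = (\<Sum>r\<in>J. if r = p then (\<Sum>q\<in>J. k r q * g q) else 0)"
      unfolding quad_form_def h_def by (rule sum.cong) auto
    then show ?thesis using fin p by simp
  qed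
  have nrm: "(\<Sum>q\<in>J. (f q + t * h q)\<^sup>2) = (\<Sum>q\<in>J. (f q)\<^sup>2) + 2 * t * f p + t\<^sup>2" for t
  proof -
    have "(\<Sum>q\<in>J. (f q + t * h q)\<^sup>2) = (\<Sum>q\<in>J. (f q)\<^sup>2 + (if q = p then 2 * t * f q + t\<^sup>2 else 0))"
      by (rule sum.cong) (auto simp: h_def power2_eq_square algebra_simps)
    then show ?thesis using fin p by (simp add: sum.distrib)
  qed
  have "0 \<le> 2 * t * (\<mu> * quad_form k J h f - f p) + t\<^sup>2 * (\<mu> * quad_form k J h h - 1)" for t
  proof -
    have "quad_form k J (\<lambda>q. f q + t * h q) (\<lambda>q. f q + t * h q)
        = quad_form k J f f + 2 * t * quad_form k J h f + t\<^sup>2 * quad_form k J h h"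
      by (rule quad_form_add_scaled) (rule sym)
    then have "(\<Sum>p\<in>J. (f p)\<^sup>2) + 2 * t * f p + t\<^sup>2
        \<le> \<mu> * (quad_form k J f f + 2 * t * quad_form k J h f + t\<^sup>2 * quad_form k J h h)"
      using optimal_boundD[OF bound, of "\<lambda>q. f q + t * h q"] nrm[of t] by metis
    then show ?thesis unfolding extremal by (simp add: algebra_simps)
  qed
  from nonneg_quadratic_linear_coeff_zero[OF this] show ?thesis by (simp add: kh)
qed

text \<open>
  If the kernel does not couple the part of \<open>f\<close> inside \<open>D\<close> to the part outside, the eigenvalue
  equation for \<open>f\<close> restricts to \<open>D\<close>; pairing it with \<open>f\<close> on \<open>D\<close> gives equality again. The
  hypothesis involves the product with \<open>f q\<close> so that it also covers indices where the kernel couples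
  but \<open>f\<close> vanishes.
\<close>

lemma extremal_restrict:
  assumes fin: "finite J" and sym: "\<And>p q. p \<in> J \<Longrightarrow> q \<in> J \<Longrightarrow> k p q = k q p"
    and bound: "optimal_bound k J \<mu>"
    and extremal: "(\<Sum>p\<in>J. (f p)\<^sup>2) = \<mu> * quad_form k J f f"
    and sep: "\<And>p q. p \<in> J \<Longrightarrow> p \<in> D \<Longrightarrow> q \<in> J \<Longrightarrow> q \<notin> D \<Longrightarrow> k p q * f q = 0"
  shows "(\<Sum>p\<in>J \<inter> D. (f p)\<^sup>2) = \<mu> * quad_form k (J \<inter> D) f f"
proof -
  have "\<mu> * (\<Sum>q\<in>J \<inter> D. k p q * f q) = f p" if "p \<in> J \<inter> D" for p
  proof -
    have "(\<Sum>q\<in>J \<inter> D. k p q * f q) = (\<Sum>q\<in>J. k p q * f q)"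
      by (rule sum.mono_neutral_left) (use fin sep that in auto)
    then show ?thesis
      using extremal_imp_eigen[OF fin sym bound extremal] that by simp
  qed
  then have "(\<Sum>p\<in>J \<inter> D. (f p)\<^sup>2) = (\<Sum>p\<in>J \<inter> D. f p * (\<mu> * (\<Sum>q\<in>J \<inter> D. k p q * f q)))"
    by (intro sum.cong) (auto simp: power2_eq_square)
  then show ?thesis by (simp add: quad_form_def sum_distrib_left mult_ac)
qed

section \<open>Matrices as kernels on finite index sets\<close>

text \<open>
  Rows and columns of the matrices below are numbered in ways that change with every deletion and
  selection of blocks. A kernel indexed by pairs (vertex, coordinate) does not change; only the
  enumeration \<open>e\<close> does.
\<close>

definition represents :: "'b mat \<Rightarrow> (nat \<Rightarrow> 'i) \<Rightarrow> 'i set \<Rightarrow> ('i \<Rightarrow> 'i \<Rightarrow> 'b) \<Rightarrow> bool" where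
  "represents A e J k \<longleftrightarrow> dim_col A = dim_row A \<and> bij_betw e {..<dim_row A} J \<and>
     (\<forall>i < dim_row A. \<forall>j < dim_row A. A $$ (i, j) = k (e i) (e j))"

lemma represents_dim:
  assumes "represents A e J k"
  shows "A \<in> carrier_mat (card J) (card J)"
  using assms bij_betw_same_card[of e "{..<dim_row A}" J] by (auto simp: represents_def)

lemma represents_cong:
  assumes "represents A e J k" and "\<And>i. i < dim_row A \<Longrightarrow> e i = e' i"
  shows "represents A e' J k"
  using assms bij_betw_cong[of "{..<dim_row A}" e e' J] by (simp add: represents_def)

lemma represents_mult_vec:
  fixes A :: "'b :: comm_semiring_0 mat"
  assumes rep: "represents A e J k" and i: "i < dim_row A" and v: "dim_vec v = dim_row A"
    and g: "\<And>j. j < dim_row A \<Longrightarrow> v $ j = g (e j)"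
  shows "(A *\<^sub>v v) $ i = (\<Sum>q\<in>J. k (e i) q * g q)"
proof -
  have "(A *\<^sub>v v) $ i = (\<Sum>j<dim_row A. k (e i) (e j) * g (e j))"
    using rep i v g
    by (auto simp: represents_def scalar_prod_def lessThan_atLeast0 intro!: sum.cong)
  also have "\<dots> = (\<Sum>q\<in>J. k (e i) q * g q)"
    using rep by (intro sum.reindex_bij_betw) (simp add: represents_def)
  finally show ?thesis .
qed

lemma represents_eigenvalue:
  fixes A :: "'b :: comm_ring_1 mat"
  assumes rep: "represents A e J k"
  shows "eigenvalue A \<mu> \<longleftrightarrow>
    (\<exists>f. (\<exists>p\<in>J. f p \<noteq> 0) \<and> (\<forall>p\<in>J. (\<Sum>q\<in>J. k p q * f q) = \<mu> * f p))" (is "_ = (\<exists>f. ?eig f)")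
proof -
  let ?m = "dim_row A"
  have bij: "bij_betw e {..<?m} J" using rep by (simp add: represents_def)
  have "eigenvector A v \<mu> \<longleftrightarrow> ?eig f"
    if v: "dim_vec v = ?m" and vf: "\<And>j. j < ?m \<Longrightarrow> v $ j = f (e j)" for v f
  proof -
    have J: "(\<forall>p\<in>J. P p) \<longleftrightarrow> (\<forall>j<?m. P (e j))" for P
      using bij by (auto simp: bij_betw_def)
    have "v \<noteq> 0\<^sub>v ?m \<longleftrightarrow> (\<exists>p\<in>J. f p \<noteq> 0)"
      using J[of "\<lambda>p. f p = 0"] v vf by (auto simp: vec_eq_iff)
    moreover have "A *\<^sub>v v = \<mu> \<cdot>\<^sub>v v \<longleftrightarrow> (\<forall>p\<in>J. (\<Sum>q\<in>J. k p q * f q) = \<mu> * f p)"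
    proof -
      have "(A *\<^sub>v v) $ i = (\<Sum>q\<in>J. k (e i) q * f q)" if "i < ?m" for i
        by (rule represents_mult_vec[OF rep that v vf])
      then show ?thesis
        unfolding J using v vf by (simp add: vec_eq_iff)
    qed
    moreover have "v \<in> carrier_vec ?m" using v by (rule carrier_vecI)
    ultimately show ?thesis unfolding eigenvector_def by blast
  qed
  note corr = this
  show ?thesis
  proof
    assume "eigenvalue A \<mu>"
    then obtain v where v: "eigenvector A v \<mu>" by (auto simp: eigenvalue_def)
    then have dim: "dim_vec v = ?m" by (auto simp: eigenvector_def)
    define f where "f = (\<lambda>p. v $ inv_into {..<?m} e p)"
    have "v $ j = f (e j)" if "j < ?m" for j
      using bij that by (simp add: f_def bij_betw_inv_into_left)
    from corr[OF dim this] v have "?eig f" by simp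
    then show "\<exists>f. ?eig f" by blast
  next
    assume "\<exists>f. ?eig f"
    then obtain f where f: "?eig f" by blast
    have "eigenvector A (vec ?m (\<lambda>j. f (e j))) \<mu>"
      using corr[of "vec ?m (\<lambda>j. f (e j))" f] f by simp
    then show "eigenvalue A \<mu>" by (auto simp: eigenvalue_def)
  qed
qed

text \<open>
  The kernel \<open>n\<close> is the inverse of \<open>k\<close>. An eigenvector \<open>g\<close> of \<open>n\<close> for the complex eigenvalue \<open>\<nu>\<close>
  satisfies \<open>g = \<nu> k g\<close>, whence \<open>|g|\<^sup>2 = \<nu> D\<close> with \<open>D = g\<^sup>* k g\<close>. By symmetry of \<open>k\<close> the number \<open>D\<close> is
  the sum of the real forms at the real and imaginary parts of \<open>g\<close>, so \<open>|\<nu>| \<le> \<mu>\<close>. Conversely an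
  extremal vector of \<open>k\<close> is an eigenvector of \<open>n\<close> for \<open>\<mu>\<close>.
\<close>

lemma spectral_radius_of_inverse:
  assumes fin: "finite J" and ne: "J \<noteq> {}"
    and sym: "\<And>p q. p \<in> J \<Longrightarrow> q \<in> J \<Longrightarrow> k p q = k q p"
    and pd: "pos_def_on k J"
    and inverse: "\<And>p r. p \<in> J \<Longrightarrow> r \<in> J \<Longrightarrow> (\<Sum>q\<in>J. k p q * n q r) = (if p = r then 1 else 0)"
    and rep: "represents A e J n"
  shows "optimal_bound k J (real_spectral_radius A)"
proof -
  obtain \<mu> where opt: "optimal_bound k J \<mu>"
    using optimal_bound_exists[OF fin ne pd] by blast
  have "0 < \<mu>" using opt by (rule optimal_bound_pos)
  let ?C = "map_mat complex_of_real A"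
  have repC: "represents ?C e J (\<lambda>p q. complex_of_real (n p q))"
    using rep by (auto simp: represents_def)
  have dimC: "?C \<in> carrier_mat (card J) (card J)" using represents_dim[OF rep] by simp
  have card: "0 < card J" using fin ne by (simp add: card_gt_0_iff)
  have inverseC: "(\<Sum>q\<in>J. of_real (k p q) * (\<Sum>r\<in>J. of_real (n q r) * g r)) = g p"
    if p: "p \<in> J" for p and g :: "'a \<Rightarrow> complex"
  proof -
    have "(\<Sum>q\<in>J. of_real (k p q) * (\<Sum>r\<in>J. of_real (n q r) * g r))
        = (\<Sum>q\<in>J. \<Sum>r\<in>J. of_real (k p q * n q r) * g r)"
      by (simp add: sum_distrib_left mult.assoc)
    also have "\<dots> = (\<Sum>r\<in>J. of_real (\<Sum>q\<in>J. k p q * n q r) * g r)"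
      by (subst sum.swap) (simp add: sum_distrib_right)
    also have "\<dots> = (\<Sum>r\<in>J. if p = r then g r else 0)"
      by (rule sum.cong) (auto simp: inverse p)
    also have "\<dots> = g p" using p fin by simp
    finally show ?thesis .
  qed
  have bound: "norm \<nu> \<le> \<mu>" if \<nu>: "\<nu> \<in> spectrum ?C" for \<nu>
  proof -
    obtain g where g: "\<exists>p\<in>J. g p \<noteq> 0" "\<And>p. p \<in> J \<Longrightarrow> (\<Sum>q\<in>J. of_real (n p q) * g q) = \<nu> * g p"
      using \<nu> by (auto simp: spectrum_def represents_eigenvalue[OF repC])
    define D where "D = quad_form k J (\<lambda>p. Re (g p)) (\<lambda>p. Re (g p)) + quad_form k J (\<lambda>p. Im (g p)) (\<lambda>p. Im (g p))"
    define S where "S = (\<Sum>p\<in>J. (cmod (g p))\<^sup>2)"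
    have eig: "g p = \<nu> * (\<Sum>q\<in>J. of_real (k p q) * g q)" if "p \<in> J" for p
    proof -
      have "g p = (\<Sum>q\<in>J. of_real (k p q) * (\<nu> * g q))"
        unfolding inverseC[OF that, of g, symmetric] by (rule sum.cong) (simp_all add: g(2))
      then show ?thesis by (simp add: sum_distrib_left mult_ac)
    qed
    have swap: "quad_form k J (\<lambda>p. Im (g p)) (\<lambda>p. Re (g p)) = quad_form k J (\<lambda>p. Re (g p)) (\<lambda>p. Im (g p))"
      unfolding quad_form_def by (subst sum.swap) (auto intro!: sum.cong simp: sym)
    have hermitian: "(\<Sum>p\<in>J. \<Sum>q\<in>J. cnj (g p) * of_real (k p q) * g q) = of_real D"
    proof (rule complex_eqI)
      have "Re (cnj (g p) * of_real (k p q) * g q)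
          = Re (g p) * k p q * Re (g q) + Im (g p) * k p q * Im (g q)" for p q
        by simp
      then show "Re (\<Sum>p\<in>J. \<Sum>q\<in>J. cnj (g p) * of_real (k p q) * g q) = Re (of_real D)"
        by (simp add: D_def quad_form_def sum.distrib)
      have "Im (cnj (g p) * of_real (k p q) * g q)
          = Re (g p) * k p q * Im (g q) - Im (g p) * k p q * Re (g q)" for p q
        by simp
      then show "Im (\<Sum>p\<in>J. \<Sum>q\<in>J. cnj (g p) * of_real (k p q) * g q) = Im (of_real D)"
        using swap by (simp add: quad_form_def sum_subtractf)
    qed
    have "of_real S = (\<Sum>p\<in>J. cnj (g p) * g p)"
      by (simp add: S_def mult.commute[of "cnj _"] complex_norm_square[symmetric])
    also have "\<dots> = (\<Sum>p\<in>J. cnj (g p) * (\<nu> * (\<Sum>q\<in>J. of_real (k p q) * g q)))"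
      by (intro sum.cong[OF refl] arg_cong2[where f = "(*)"] refl eig)
    also have "\<dots> = \<nu> * (\<Sum>p\<in>J. \<Sum>q\<in>J. cnj (g p) * of_real (k p q) * g q)"
      by (simp add: sum_distrib_left mult_ac)
    also have "\<dots> = \<nu> * of_real D" by (simp only: hermitian)
    finally have "norm (complex_of_real S) = norm (\<nu> * complex_of_real D)" by simp
    then have SD: "\<bar>S\<bar> = norm \<nu> * \<bar>D\<bar>" by (simp add: norm_mult)
    have "0 < S" unfolding S_def using g(1) fin
      by (meson norm_eq_zero sum_pos2 zero_le_power2 zero_less_power2)
    have "S = (\<Sum>p\<in>J. (Re (g p))\<^sup>2) + (\<Sum>p\<in>J. (Im (g p))\<^sup>2)"
      by (simp add: S_def cmod_power2 sum.distrib)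
    also have "\<dots> \<le> \<mu> * D"
      unfolding D_def distrib_left by (intro add_mono optimal_boundD[OF opt])
    finally have "S \<le> \<mu> * D" .
    then have "0 < D" using \<open>0 < S\<close> \<open>0 < \<mu>\<close> by (smt (verit) mult_nonneg_nonpos)
    then have "norm \<nu> * D \<le> \<mu> * D" using SD \<open>S \<le> \<mu> * D\<close> \<open>0 < S\<close> by simp
    then show ?thesis using \<open>0 < D\<close> by simp
  qed
  obtain f where f: "\<exists>p\<in>J. f p \<noteq> 0" "(\<Sum>p\<in>J. (f p)\<^sup>2) = \<mu> * quad_form k J f f"
    using opt by (auto simp: optimal_bound_def)
  have kf: "\<mu> * (\<Sum>q\<in>J. k p q * f q) = f p" if "p \<in> J" for p
    by (rule extremal_imp_eigen[OF fin _ opt f(2) that]) (rule sym)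
  \<comment> \<open>From \<open>k n = 1\<close> and \<open>\<mu> k f = f\<close>, the kernel \<open>k\<close> annihilates \<open>n f - \<mu> f\<close>, and \<open>k\<close> is injective.\<close>
  define g where "g = (\<lambda>q. (\<Sum>r\<in>J. n q r * f r) - \<mu> * f q)"
  have "(\<Sum>q\<in>J. k p q * g q) = 0" if p: "p \<in> J" for p
  proof -
    have "of_real (\<Sum>q\<in>J. k p q * (\<Sum>r\<in>J. n q r * f r)) = complex_of_real (f p)"
      using inverseC[OF p, of "\<lambda>r. of_real (f r)"] by simp
    then have "(\<Sum>q\<in>J. k p q * (\<Sum>r\<in>J. n q r * f r)) = f p"
      using of_real_eq_iff by blast
    moreover have "(\<Sum>q\<in>J. k p q * (\<mu> * f q)) = f p"
      using kf[OF p] by (simp add: sum_distrib_left mult_ac)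
    ultimately show ?thesis by (simp add: g_def right_diff_distrib sum_subtractf)
  qed
  then have "quad_form k J g g = 0"
    unfolding quad_form_def
    by (simp add: sum_distrib_left[symmetric] mult.assoc)
  then have g0: "g p = 0" if "p \<in> J" for p
    using pd that unfolding pos_def_on_def by force
  have "eigenvalue ?C (of_real \<mu>)"
    unfolding represents_eigenvalue[OF repC]
  proof (intro exI conjI ballI)
    show "\<exists>p\<in>J. complex_of_real (f p) \<noteq> 0" using f(1) by simp
    fix p assume "p \<in> J"
    then have "(\<Sum>q\<in>J. n p q * f q) = \<mu> * f p" using g0 by (simp add: g_def)
    then have "complex_of_real (\<Sum>q\<in>J. n p q * f q) = of_real (\<mu> * f p)" by simp
    then show "(\<Sum>q\<in>J. complex_of_real (n p q) * of_real (f q)) = of_real \<mu> * of_real (f p)"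
      by simp
  qed
  then have "norm (complex_of_real \<mu>) \<in> norm ` spectrum ?C"
    by (intro imageI) (simp add: spectrum_def)
  then have "\<mu> \<le> spectral_radius ?C"
    using spectral_radius_mem_max(2)[OF dimC card] \<open>0 < \<mu>\<close> by fastforce
  moreover have "spectral_radius ?C \<le> \<mu>"
    using spectral_radius_mem_max(1)[OF dimC card] bound by auto
  ultimately show ?thesis using opt by (simp add: real_spectral_radius_def)
qed

text \<open>
  A positive definite kernel has trivial null space, so the matrix has nonzero determinant.
\<close>

lemma represents_inverse_exists:
  fixes A :: "real mat"
  assumes rep: "represents A e J k" and pd: "pos_def_on k J"
  obtains N n where "mat_inverse A = Some N" "represents N e J n"
    "\<And>p r. p \<in> J \<Longrightarrow> r \<in> J \<Longrightarrow> (\<Sum>q\<in>J. k p q * n q r) = (if p = r then 1 else 0)"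
proof -
  let ?m = "dim_row A"
  have A: "A \<in> carrier_mat ?m ?m" and bij: "bij_betw e {..<?m} J"
    using rep by (auto simp: represents_def)
  have "det A \<noteq> 0"
  proof
    assume "det A = 0"
    then obtain v where "v \<in> carrier_vec ?m" "v \<noteq> 0\<^sub>v ?m" "A *\<^sub>v v = 0\<^sub>v ?m"
      using det_0_iff_vec_prod_zero_field[OF A] by blast
    then have "eigenvalue A 0"
      by (auto simp: eigenvalue_def eigenvector_def intro!: exI[of _ v])
    then obtain f where f: "\<exists>p\<in>J. f p \<noteq> 0" "\<And>p. p \<in> J \<Longrightarrow> (\<Sum>q\<in>J. k p q * f q) = 0"
      using represents_eigenvalue[OF rep] by auto
    have "quad_form k J f f = 0"
      unfolding quad_form_def by (simp add: sum_distrib_left[symmetric] mult.assoc f(2))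
    then show False using pd f(1) unfolding pos_def_on_def by force
  qed
  then have unit: "A \<in> Units (ring_mat TYPE(real) ?m ())" by (rule det_non_zero_imp_unit[OF A])
  then obtain N where N: "mat_inverse A = Some N"
    using mat_inverse(1)[OF A, of "()"] by (cases "mat_inverse A") auto
  then have AN: "A * N = 1\<^sub>m ?m" "N \<in> carrier_mat ?m ?m"
    using mat_inverse(2)[OF A] by auto
  then have dimN: "dim_row N = ?m" "dim_col N = ?m" by auto
  define n where "n = (\<lambda>p q. N $$ (inv_into {..<?m} e p, inv_into {..<?m} e q))"
  have n_e: "n (e i) (e j) = N $$ (i, j)" if "i < ?m" "j < ?m" for i j
    using bij that by (simp add: n_def bij_betw_inv_into_left)
  have repN: "represents N e J n"
    using dimN bij by (simp add: represents_def n_e)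
  have "(\<Sum>q\<in>J. k (e i) q * n q (e j)) = (if e i = e j then 1 else 0)" if ij: "i < ?m" "j < ?m" for i j
  proof -
    have "(\<Sum>q\<in>J. k (e i) q * n q (e j)) = (A *\<^sub>v col N j) $ i"
    proof (rule represents_mult_vec[OF rep ij(1), symmetric])
      show "dim_vec (col N j) = ?m" using dimN by simp
      show "col N j $ l = n (e l) (e j)" if "l < ?m" for l
        using that ij(2) dimN n_e by simp
    qed
    also have "\<dots> = (A * N) $$ (i, j)" using ij dimN by simp
    also have "\<dots> = (if e i = e j then 1 else 0)"
      using ij bij by (auto simp: AN(1) bij_betw_def inj_on_def)
    finally show ?thesis .
  qed
  then have "(\<Sum>q\<in>J. k p q * n q r) = (if p = r then 1 else 0)" if "p \<in> J" "r \<in> J" for p r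
    using that bij by (auto simp: bij_betw_def)
  then show thesis using that N repN by blast
qed

text \<open>
  The inverse of \<open>pick I\<close> is the map counting the smaller elements of \<open>I\<close>.
\<close>

lemma pick_bij_betw:
  assumes "finite I"
  shows "bij_betw (pick I) {..<card I} I"
proof -
  let ?rank = "\<lambda>i. card {a \<in> I. a < i}"
  have inj: "inj_on ?rank I"
    by (rule inj_on_inverseI) (rule pick_card_in_set)
  have "?rank i < card I" if "i \<in> I" for i
    by (rule psubset_card_mono[OF assms]) (use that in blast)
  then have "?rank ` I \<subseteq> {..<card I}" by blast
  then have "?rank ` I = {..<card I}"
    by (rule card_subset_eq[rotated]) (simp_all add: card_image[OF inj])
  with inj have "bij_betw ?rank I {..<card I}" by (simp add: bij_betw_def)
  then have "bij_betw (inv_into I ?rank) {..<card I} I" by (rule bij_betw_inv_into)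
  moreover have "inv_into I ?rank n = pick I n" if n: "n < card I" for n
  proof -
    obtain i where "i \<in> I" "n = ?rank i"
      using n \<open>?rank ` I = {..<card I}\<close> by blast
    then show ?thesis
      using pick_card_in_set[of i I] inv_into_f_f[OF inj] by simp
  qed
  ultimately show ?thesis
    using bij_betw_cong[of "{..<card I}" "inv_into I ?rank" "pick I" I] by simp
qed

definition block_index :: "nat \<Rightarrow> 'a list \<Rightarrow> nat \<Rightarrow> 'a \<times> nat" where
  "block_index s xs i = (xs ! (i div s), i mod s)"

lemma block_index_bij_betw:
  assumes "distinct xs"
  shows "bij_betw (block_index s xs) {..<length xs * s} (set xs \<times> {..<s})"
proof -
  have inj: "inj_on (block_index s xs) {..<length xs * s}"
  proof (rule inj_onI)
    fix i j assume "i \<in> {..<length xs * s}" "j \<in> {..<length xs * s}"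
      and eq: "block_index s xs i = block_index s xs j"
    then have "i div s < length xs" "j div s < length xs"
      by (auto intro: less_mult_imp_div_less)
    with eq have "i div s = j div s" "i mod s = j mod s"
      using assms by (auto simp: block_index_def nth_eq_iff_index_eq)
    then show "i = j" by (metis div_mult_mod_eq)
  qed
  have "block_index s xs i \<in> set xs \<times> {..<s}" if "i < length xs * s" for i
  proof -
    have "i div s < length xs" using that by (rule less_mult_imp_div_less)
    moreover have "0 < s" using that by (cases s) auto
    ultimately show ?thesis by (simp add: block_index_def)
  qed
  then have "block_index s xs ` {..<length xs * s} \<subseteq> set xs \<times> {..<s}" by blast
  then have "block_index s xs ` {..<length xs * s} = set xs \<times> {..<s}"
    by (rule card_subset_eq[rotated]) (simp_all add: card_image[OF inj] card_cartesian_product distinct_card[OF assms])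
  with inj show ?thesis by (simp add: bij_betw_def)
qed

text \<open>
  Which enumeration arises does not matter for spectral radii, only that it is a bijection onto
  the selected blocks.
\<close>

lemma represents_principal_blocks_pick:
  fixes S :: "'a set"
  assumes rep: "represents A (block_index s xs) (set xs \<times> {..<s}) k" and "distinct xs"
  defines "I \<equiv> {i. i < length xs * s \<and> xs ! (i div s) \<in> S}"
  shows "represents (principal_blocks s xs S A) (\<lambda>i. block_index s xs (pick I i)) ((set xs \<inter> S) \<times> {..<s}) k"
proof -
  have dim: "dim_row A = length xs * s" "dim_col A = length xs * s"
    using represents_dim[OF rep] \<open>distinct xs\<close> by (auto simp: card_cartesian_product distinct_card)
  have fin: "finite I" by (simp add: I_def)
  have I: "{i. i < length xs * s \<and> i \<in> I} = I" by (auto simp: I_def)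
  have dim': "dim_row (submatrix A I I) = card I" "dim_col (submatrix A I I) = card I"
    by (simp_all add: dim_submatrix dim I)
  have pick: "pick I i \<in> I" if "i < card I" for i
    using bij_betwE[OF pick_bij_betw[OF fin]] that by auto
  have "block_index s xs ` I = (set xs \<inter> S) \<times> {..<s}"
  proof -
    have "block_index s xs ` I = {p \<in> block_index s xs ` {..<length xs * s}. fst p \<in> S}"
      by (auto simp: I_def block_index_def)
    also have "\<dots> = {p \<in> set xs \<times> {..<s}. fst p \<in> S}"
      using block_index_bij_betw[OF \<open>distinct xs\<close>, of s] by (simp add: bij_betw_def)
    finally show ?thesis by auto
  qed
  then have "bij_betw (block_index s xs) I ((set xs \<inter> S) \<times> {..<s})"
    using bij_betw_subset[OF block_index_bij_betw[OF \<open>distinct xs\<close>, of s], of I] by (auto simp: I_def)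
  from bij_betw_trans[OF pick_bij_betw[OF fin] this]
  have "bij_betw (\<lambda>i. block_index s xs (pick I i)) {..<card I} ((set xs \<inter> S) \<times> {..<s})"
    by (simp add: comp_def)
  moreover have "submatrix A I I $$ (i, j) = k (block_index s xs (pick I i)) (block_index s xs (pick I j))"
    if "i < card I" "j < card I" for i j
  proof -
    have "submatrix A I I $$ (i, j) = A $$ (pick I i, pick I j)"
      by (rule submatrix_index) (simp_all add: dim I that)
    moreover have "pick I i < length xs * s" "pick I j < length xs * s"
      using pick that by (auto simp: I_def)
    ultimately show ?thesis using rep by (simp add: represents_def dim)
  qed
  ultimately show ?thesis
    unfolding principal_blocks_def Let_def I_def[symmetric] by (simp add: represents_def dim')
qed

text \<open>
  Here the enumeration must be the block order of the filtered list, since a further selection of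
  blocks refers to that order. Deleting the block at position \<open>m = length ys\<close> keeps the indices below
  \<open>m * s\<close> and shifts the others by \<open>s\<close>.
\<close>

lemma represents_principal_blocks_delete:
  assumes rep: "represents A (block_index s xs) (set xs \<times> {..<s}) k" and dist: "distinct xs"
    and v: "v \<in> set xs"
  shows "represents (principal_blocks s xs (- {v}) A) (block_index s (filter (\<lambda>x. x \<noteq> v) xs))
    ((set xs - {v}) \<times> {..<s}) k"
proof -
  obtain ys zs where xs: "xs = ys @ v # zs" and "v \<notin> set ys"
    using split_list_first[OF v] by blast
  with dist have "v \<notin> set zs" by auto
  let ?I = "{i. i < length xs * s \<and> xs ! (i div s) \<in> - {v}}"
  let ?m = "length ys * s"
  have filter: "filter (\<lambda>x. x \<noteq> v) xs = ys @ zs"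
  proof -
    have "filter (\<lambda>x. x \<noteq> v) ys = ys"
      by (rule filter_True) (use \<open>v \<notin> set ys\<close> in blast)
    moreover have "filter (\<lambda>x. x \<noteq> v) zs = zs"
      by (rule filter_True) (use \<open>v \<notin> set zs\<close> in blast)
    ultimately show ?thesis by (simp add: xs)
  qed
  have nth_v: "xs ! a \<noteq> v \<longleftrightarrow> a \<noteq> length ys" if "a < length xs" for a
    using nth_eq_iff_index_eq[OF dist that, of "length ys"] by (simp add: xs)
  have I: "?I = {i. i < length xs * s \<and> i div s \<noteq> length ys}"
    using nth_v by (auto dest: less_mult_imp_div_less)
  note main = represents_principal_blocks_pick[OF rep dist, of "- {v}"]
  have dim: "dim_row (principal_blocks s xs (- {v}) A) = (length ys + length zs) * s"
    using represents_dim[OF main] dist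
    by (simp add: card_cartesian_product xs Int_Diff Diff_eq[symmetric] distinct_card card_Un_disjoint)
  \<comment> \<open>\<open>pick ?I i\<close> is the element of \<open>?I\<close> with exactly \<open>i\<close> smaller elements in \<open>?I\<close>.\<close>
  have pick: "pick ?I i = (if i < ?m then i else i + s)" if i: "i < (length ys + length zs) * s" for i
  proof -
    have "s > 0" using i by (cases s) auto
    show ?thesis
    proof (cases "i < ?m")
      case True
      then have "i div s < length ys" by (rule less_mult_imp_div_less)
      moreover have "i < length xs * s" using True by (simp add: xs distrib_right)
      ultimately have "i \<in> ?I" unfolding I by simp
      moreover have "{a \<in> ?I. a < i} = {..<i}"
        unfolding I using \<open>i div s < length ys\<close> \<open>i < length xs * s\<close>
        by (auto dest: div_le_mono[OF less_imp_le, where k = s])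
      ultimately show ?thesis using pick_card_in_set[of i ?I] True by simp
    next
      case False
      have div: "a div s = length ys \<longleftrightarrow> a \<in> {?m..<?m + s}" for a
      proof
        assume "a div s = length ys"
        then show "a \<in> {?m..<?m + s}"
          using div_times_less_eq_dividend[of a s] dividend_less_div_times[of s a] \<open>s > 0\<close>
          by (simp add: add.commute)
      next
        assume "a \<in> {?m..<?m + s}"
        then show "a div s = length ys"
          by (intro div_nat_eqI) (simp_all add: mult.commute)
      qed
      have "i + s \<in> ?I"
        unfolding I using i False by (auto simp: div xs algebra_simps)
      moreover have "{a \<in> ?I. a < i + s} = {..<i + s} - {?m..<?m + s}"
        unfolding I using i by (auto simp: div xs algebra_simps)
      moreover have "card ({..<i + s} - {?m..<?m + s}) = i"
        using False by (subst card_Diff_subset) auto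
      ultimately show ?thesis using pick_card_in_set[of "i + s" ?I] False by simp
    qed
  qed
  have index: "block_index s xs (pick ?I i) = block_index s (filter (\<lambda>x. x \<noteq> v) xs) i"
    if i: "i < (length ys + length zs) * s" for i
  proof -
    have "s > 0" using i by (cases s) auto
    have "length ys \<le> i div s" if "\<not> i < ?m"
      using that \<open>s > 0\<close> by (simp add: less_eq_div_iff_mult_less_eq)
    moreover have "i div s < length ys" if "i < ?m"
      using that by (rule less_mult_imp_div_less)
    ultimately show ?thesis
      using \<open>s > 0\<close> unfolding pick[OF i] filter block_index_def
      by (auto simp: xs nth_append Suc_diff_le)
  qed
  have "set xs \<inter> - {v} = set xs - {v}" by auto
  with main have "represents (principal_blocks s xs (- {v}) A) (\<lambda>i. block_index s xs (pick ?I i))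
      ((set xs - {v}) \<times> {..<s}) k" by (simp only:)
  then show ?thesis by (rule represents_cong) (use index dim in simp)
qed

section \<open>Branches of a tree\<close>

text \<open>
  Vertex deletion that stays within the pair digraphs, so that their walk lemmas apply to it.
\<close>

definition pair_del_vert :: "'a pair_pre_digraph \<Rightarrow> 'a \<Rightarrow> 'a pair_pre_digraph" where
  "pair_del_vert T x = \<lparr>pverts = pverts T - {x}, parcs = {(u, w) \<in> parcs T. u \<noteq> x \<and> w \<noteq> x}\<rparr>"

lemma pair_del_vert_simps [simp]:
  "pverts (pair_del_vert T x) = pverts T - {x}"
  "(u, w) \<in> parcs (pair_del_vert T x) \<longleftrightarrow> (u, w) \<in> parcs T \<and> u \<noteq> x \<and> w \<noteq> x"
  by (simp_all add: pair_del_vert_def)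

lemma branches_eq_sccs: "branches T x = pre_digraph.sccs_verts (with_proj (pair_del_vert T x))"
proof -
  have "pre_digraph.del_vert (with_proj T) x = with_proj (pair_del_vert T x)"
    by (auto simp: pre_digraph.del_vert_def with_proj_def pair_del_vert_def)
  then show ?thesis by (simp add: branches_def)
qed

locale undirected_tree_graph =
  fixes T :: "'a pair_pre_digraph"
  assumes tree: "undirected_tree T"
begin

lemma pair_graph_T: "pair_graph T"
  using tree by (simp add: undirected_tree_def)

sublocale pair_graph T by (rule pair_graph_T)

lemma adj_sym: "(u, w) \<in> parcs T \<Longrightarrow> (w, u) \<in> parcs T"
  by (rule arcs_symmetric)

lemma adj_verts: "(u, w) \<in> parcs T \<Longrightarrow> u \<in> pverts T \<and> w \<in> pverts T \<and> u \<noteq> w"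
  using in_arcsD1 in_arcsD2 pair_no_loops by fastforce

lemma finite_verts: "finite (pverts T)"
  by (rule pair_finite_verts)

lemma tree_connected:
  assumes "u \<in> pverts T" "w \<in> pverts T"
  shows "(u, w) \<in> (parcs T)\<^sup>*"
proof -
  have "Digraph_Component.connected (with_proj T)"
    using tree by (simp add: undirected_tree_def)
  then have "u \<rightarrow>\<^sup>*\<^bsub>with_proj (mk_symmetric (with_proj T))\<^esub> w"
    using assms by (auto simp: Digraph_Component.connected_def strongly_connected_def mk_symmetric_def)
  then have "(u, w) \<in> (parcs (mk_symmetric (with_proj T)))\<^sup>*"
    by (auto simp: reachable_def elim: rtrancl_on_rtranclI)
  moreover have "parcs (mk_symmetric (with_proj T)) \<subseteq> parcs T"
    by (auto simp: mk_symmetric_def adj_sym)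
  ultimately show ?thesis using rtrancl_mono by blast
qed

lemma pair_wf_del_vert: "pair_wf_digraph (pair_del_vert T x)"
  by unfold_locales (auto dest: adj_verts)

lemma reachable_del_vert_iff:
  "u \<rightarrow>\<^sup>*\<^bsub>with_proj (pair_del_vert T x)\<^esub> w \<longleftrightarrow>
    u \<in> pverts T - {x} \<and> (u, w) \<in> (parcs (pair_del_vert T x))\<^sup>*"
proof -
  interpret H: pair_wf_digraph "pair_del_vert T x" by (rule pair_wf_del_vert)
  show ?thesis
  proof (cases "u \<in> pverts T - {x}")
    case True
    then show ?thesis
      using H.reachable_conv'[of u w] unfolding pair_del_vert_simps(1) by blast
  next
    case False
    then show ?thesis
      using H.reachable_in_verts(1)[of u w] unfolding pair_del_vert_simps(1) by blast
  qed
qed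

lemma reach_del_vert_sym:
  "(u, w) \<in> (parcs (pair_del_vert T x))\<^sup>* \<Longrightarrow> (w, u) \<in> (parcs (pair_del_vert T x))\<^sup>*"
  by (rule symD[OF sym_rtrancl]) (auto simp: sym_def adj_sym)

text \<open>
  In a symmetric digraph mutual reachability is reachability, so the branches are the equivalence
  classes of reachability after deletion of \<open>x\<close>.
\<close>

lemma in_branches_iff:
  "B \<in> branches T x \<longleftrightarrow> B \<noteq> {} \<and> B \<subseteq> pverts T - {x} \<and>
    (\<forall>u\<in>B. \<forall>w. w \<in> B \<longleftrightarrow> (u, w) \<in> (parcs (pair_del_vert T x))\<^sup>*)"
  (is "?L \<longleftrightarrow> ?R")
proof -
  let ?E = "(parcs (pair_del_vert T x))\<^sup>*"
  have L: "?L \<longleftrightarrow> B \<noteq> {} \<and> (\<forall>u\<in>B. \<forall>w\<in>B. u \<in> pverts T - {x} \<and> (u, w) \<in> ?E) \<and>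
      (\<forall>u\<in>B. \<forall>w. w \<notin> B \<longrightarrow> \<not> (u \<in> pverts T - {x} \<and> (u, w) \<in> ?E)
        \<or> \<not> (w \<in> pverts T - {x} \<and> (w, u) \<in> ?E))"
    unfolding branches_eq_sccs pre_digraph.sccs_verts_def reachable_del_vert_iff mem_Collect_eq ..
  have stay: "w \<in> pverts T - {x}" if "(u, w) \<in> ?E" "u \<in> pverts T - {x}" for u w
    using that by (induction rule: rtrancl_induct) (use adj_verts in auto)
  show ?thesis unfolding L using stay reach_del_vert_sym[of _ _ x] by blast
qed

lemma branch_closed:
  assumes "B \<in> branches T x" "p \<in> B" "(p, q) \<in> parcs T" "q \<noteq> x"
  shows "q \<in> B"
proof -
  have "p \<noteq> x" using assms(1,2) by (auto simp: in_branches_iff)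
  then have "(p, q) \<in> parcs (pair_del_vert T x)" using assms by simp
  then show ?thesis using assms(1,2) by (meson in_branches_iff r_into_rtrancl)
qed

lemma branch_disjoint:
  assumes "B \<in> branches T x" "B' \<in> branches T x" "w \<in> B" "w \<in> B'"
  shows "B = B'"
  using assms unfolding in_branches_iff by blast

lemma branch_cover:
  assumes "w \<in> pverts T" "w \<noteq> x"
  obtains B where "B \<in> branches T x" "w \<in> B"
proof
  let ?B = "{u. (w, u) \<in> (parcs (pair_del_vert T x))\<^sup>*}"
  have "u \<in> pverts T - {x}" if "(w, u) \<in> (parcs (pair_del_vert T x))\<^sup>*" for u
    using that by (induction rule: rtrancl_induct) (use assms adj_verts in auto)
  moreover have "(w, u') \<in> (parcs (pair_del_vert T x))\<^sup>* \<longleftrightarrow> (u, u') \<in> (parcs (pair_del_vert T x))\<^sup>*"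
    if "(w, u) \<in> (parcs (pair_del_vert T x))\<^sup>*" for u u'
    using that reach_del_vert_sym rtrancl_trans by metis
  ultimately show "?B \<in> branches T x"
    unfolding in_branches_iff by blast
  show "w \<in> ?B" by simp
qed

text \<open>
  This is where acyclicity enters: a path in the branch between two neighbours of \<open>a\<close> closes up
  through \<open>a\<close> to a cycle.
\<close>

lemma branch_unique_neighbour:
  assumes B: "B \<in> branches T a" and w: "w1 \<in> B" "w2 \<in> B"
    and arcs: "(a, w1) \<in> parcs T" "(a, w2) \<in> parcs T"
  shows "w1 = w2"
proof (rule ccontr)
  assume "w1 \<noteq> w2"
  interpret H: pair_wf_digraph "pair_del_vert T a" by (rule pair_wf_del_vert)
  have "w1 \<rightarrow>\<^sup>*\<^bsub>with_proj (pair_del_vert T a)\<^esub> w2"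
    using B w by (auto simp: reachable_del_vert_iff in_branches_iff)
  then obtain p where p: "H.apath w1 p w2" by (auto simp: H.reachable_apath)
  then have walk: "set p \<subseteq> parcs (pair_del_vert T a)" "pcas w1 p w2" "distinct (pawalk_verts w1 p)"
    by (auto simp: H.apath_def H.awalk_def)
  have "a \<notin> set (pawalk_verts w1 p)"
  proof -
    have "H.awalk w1 p w2" using p by (simp add: H.apath_def)
    then have "set (pawalk_verts w1 p) \<subseteq> pverts (pair_del_vert T a)"
      unfolding H.awalk_conv by blast
    then show ?thesis by auto
  qed
  have "p \<noteq> []" using walk(2) \<open>w1 \<noteq> w2\<close> by auto
  have "awalk w1 p w2"
    using walk adj_verts[OF arcs(1)] by (auto simp: awalk_def)
  let ?c = "(a, w1) # p @ [(w2, a)]"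
  have "awalk a ?c a"
    using \<open>awalk w1 p w2\<close> arcs adj_sym adj_verts by (auto simp: awalk_simps)
  moreover have "pawalk_verts u (q @ [(w2, a)]) = pawalk_verts u q @ [a]" if "pcas u q w2" for u q
    using that by (induction q arbitrary: u) auto
  ultimately have "cycle ?c"
    using walk \<open>a \<notin> set (pawalk_verts w1 p)\<close> unfolding cycle_def by (intro exI[of _ a]) simp
  moreover have "3 \<le> length ?c" using \<open>p \<noteq> []\<close> by (cases p) auto
  ultimately show False using tree unfolding undirected_tree_def by blast
qed

text \<open>
  A walk from \<open>b \<in> B\<close> to \<open>v\<close> cannot leave \<open>B\<close> before it reaches \<open>v\<close>, hence it avoids \<open>x\<close> until then.
\<close>

lemma branch_subset_opposite_branch:
  assumes B: "B \<in> branches T v" and "x \<notin> B" and C: "C \<in> branches T x" and v: "v \<in> C"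
  shows "B \<subseteq> C"
proof
  fix b assume "b \<in> B"
  have "x \<noteq> v" "v \<in> pverts T" using C v by (auto simp: in_branches_iff)
  have "(b, v) \<in> (parcs T)\<^sup>*"
    using tree_connected B \<open>b \<in> B\<close> \<open>v \<in> pverts T\<close> by (auto simp: in_branches_iff)
  then have "b \<in> insert v B \<longrightarrow> (b, v) \<in> (parcs (pair_del_vert T x))\<^sup>*"
  proof (induction rule: converse_rtrancl_induct)
    case (step p q)
    show ?case
    proof (intro impI)
      assume p: "p \<in> insert v B"
      show "(p, v) \<in> (parcs (pair_del_vert T x))\<^sup>*"
      proof (cases "p = v")
        case False
        then have "q \<in> insert v B" using branch_closed[OF B, of p q] p step(1) by auto
        moreover from this have "(p, q) \<in> parcs (pair_del_vert T x)"
          using step(1) p \<open>x \<notin> B\<close> \<open>x \<noteq> v\<close> by auto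
        ultimately show ?thesis using step.IH by (meson converse_rtrancl_into_rtrancl)
      qed simp
    qed
  qed simp
  then show "b \<in> C" using \<open>b \<in> B\<close> C v reach_del_vert_sym unfolding in_branches_iff by blast
qed

end

section \<open>The Laplacian of a weighted tree\<close>

lemma quad_form_polarize:
  "quad_form k J f (\<lambda>p. f p - g p) + quad_form k J g (\<lambda>p. g p - f p)
    = quad_form k J (\<lambda>p. f p - g p) (\<lambda>p. f p - g p)"
  unfolding quad_form_def sum.distrib[symmetric]
  by (intro sum.cong refl) (simp add: algebra_simps)

lemma pos_def_mat_imp_pos_def_on:
  assumes "pos_def_mat s A"
  shows "pos_def_on (\<lambda>k l. A $$ (k, l)) {..<s}"
  unfolding pos_def_on_def
proof (intro allI impI)
  fix f :: "nat \<Rightarrow> real" assume "\<exists>k\<in>{..<s}. f k \<noteq> 0"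
  have A: "dim_row A = s" "dim_col A = s" using assms by (auto simp: pos_def_mat_def)
  let ?x = "vec s f"
  have "?x \<noteq> 0\<^sub>v s" using \<open>\<exists>k\<in>{..<s}. f k \<noteq> 0\<close> by (auto simp: vec_eq_iff)
  then have "0 < ?x \<bullet> (A *\<^sub>v ?x)" using assms by (simp add: pos_def_mat_def)
  also have "?x \<bullet> (A *\<^sub>v ?x) = quad_form (\<lambda>k l. A $$ (k, l)) {..<s} f f"
    by (simp add: scalar_prod_def A quad_form_def lessThan_atLeast0 sum_distrib_left mult.assoc)
  finally show "0 < quad_form (\<lambda>k l. A $$ (k, l)) {..<s} f f" .
qed

lemma pos_def_mat_symmetric:
  assumes "pos_def_mat s A" "k < s" "l < s"
  shows "A $$ (k, l) = A $$ (l, k)"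
proof -
  have "transpose_mat A = A" "dim_row A = s" "dim_col A = s"
    using assms(1) by (auto simp: pos_def_mat_def)
  then show ?thesis using assms(2,3) by (metis index_transpose_mat(1))
qed

locale weighted_tree = undirected_tree_graph T for T :: "'a pair_pre_digraph" +
  fixes s :: nat and W :: "'a set \<Rightarrow> real mat"
  assumes s_pos: "1 \<le> s"
    and weight_pos_def: "\<And>u w. (u, w) \<in> parcs T \<Longrightarrow> pos_def_mat s (W {u, w})"
begin

definition lap :: "'a \<times> nat \<Rightarrow> 'a \<times> nat \<Rightarrow> real" where
  "lap p q = laplacian_block T s W (fst p) (fst q) $$ (snd p, snd q)"

lemma lap_diag:
  "k < s \<Longrightarrow> l < s \<Longrightarrow> lap (u, k) (u, l) = (\<Sum>w | (u, w) \<in> parcs T. W {u, w} $$ (k, l))"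
  by (simp add: lap_def laplacian_block_def)

lemma lap_adjacent:
  "(u, w) \<in> parcs T \<Longrightarrow> k < s \<Longrightarrow> l < s \<Longrightarrow> lap (u, k) (w, l) = - W {u, w} $$ (k, l)"
  using adj_verts[of u w] weight_pos_def[of u w]
  by (auto simp: lap_def laplacian_block_def pos_def_mat_def)

lemma lap_nonadjacent:
  "u \<noteq> w \<Longrightarrow> (u, w) \<notin> parcs T \<Longrightarrow> k < s \<Longrightarrow> l < s \<Longrightarrow> lap (u, k) (w, l) = 0"
  by (simp add: lap_def laplacian_block_def)

lemma lap_symmetric:
  assumes "snd p < s" "snd q < s"
  shows "lap p q = lap q p"
proof -
  obtain u k w l where pq: "p = (u, k)" "q = (w, l)" by (cases p, cases q) auto
  have weight: "W {u, w} $$ (k, l) = W {u, w} $$ (l, k)" if "(u, w) \<in> parcs T" for u w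
    using pos_def_mat_symmetric[OF weight_pos_def[OF that]] assms by (simp add: pq)
  consider "u = w" | "(u, w) \<in> parcs T" | "u \<noteq> w" "(u, w) \<notin> parcs T" by blast
  then show ?thesis
  proof cases
    case 1
    then show ?thesis using assms weight by (auto simp: pq lap_diag intro!: sum.cong)
  next
    case 2
    then show ?thesis
      using assms weight[OF 2] adj_sym[OF 2] by (simp add: pq lap_adjacent insert_commute)
  next
    case 3
    then have "(w, u) \<notin> parcs T" using adj_sym by blast
    with 3 show ?thesis
      using assms lap_nonadjacent[of u w k l] lap_nonadjacent[of w u l k] by (simp add: pq)
  qed
qed

lemma lap_row:
  assumes "u \<in> pverts T" "k < s"
  shows "(\<Sum>q \<in> pverts T \<times> {..<s}. lap (u, k) q * z q)
    = (\<Sum>w | (u, w) \<in> parcs T. \<Sum>l<s. W {u, w} $$ (k, l) * (z (u, l) - z (w, l)))"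
proof -
  let ?N = "{w. (u, w) \<in> parcs T}"
  have N: "?N \<subseteq> pverts T - {u}" using adj_verts by auto
  have row: "(\<Sum>w\<in>pverts T. lap (u, k) (w, l) * z (w, l))
      = (\<Sum>w\<in>?N. W {u, w} $$ (k, l) * (z (u, l) - z (w, l)))" if "l < s" for l
  proof -
    have "(\<Sum>w\<in>pverts T. lap (u, k) (w, l) * z (w, l))
        = lap (u, k) (u, l) * z (u, l) + (\<Sum>w\<in>pverts T - {u}. lap (u, k) (w, l) * z (w, l))"
      by (rule sum.remove[OF finite_verts assms(1)])
    also have "(\<Sum>w\<in>pverts T - {u}. lap (u, k) (w, l) * z (w, l))
        = (\<Sum>w\<in>?N. - W {u, w} $$ (k, l) * z (w, l))"
      by (rule sum.mono_neutral_cong_right)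
        (use N finite_verts assms(2) that in \<open>auto simp: lap_adjacent lap_nonadjacent\<close>)
    finally show ?thesis
      using assms(2) that
      by (simp add: lap_diag sum_distrib_right sum_subtractf right_diff_distrib sum_negf)
  qed
  have "(\<Sum>q \<in> pverts T \<times> {..<s}. lap (u, k) q * z q)
      = (\<Sum>l<s. \<Sum>w\<in>pverts T. lap (u, k) (w, l) * z (w, l))"
    by (subst sum.swap) (simp add: sum.cartesian_product)
  also have "\<dots> = (\<Sum>l<s. \<Sum>w\<in>?N. W {u, w} $$ (k, l) * (z (u, l) - z (w, l)))"
    by (rule sum.cong) (simp_all add: row)
  finally show ?thesis by (subst sum.swap)
qed

lemma lap_off_branch:
  assumes "B \<in> branches T x" "fst p \<in> B" "fst q \<notin> B" "fst q \<noteq> x" "snd p < s" "snd q < s"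
  shows "lap p q = 0"
proof -
  have "(fst p, fst q) \<notin> parcs T" using branch_closed assms(1-4) by blast
  moreover have "fst p \<noteq> fst q" using assms(2,3) by auto
  ultimately show ?thesis
    using lap_nonadjacent[of "fst p" "fst q" "snd p" "snd q"] assms(5,6) by simp
qed

definition weight_form :: "'a \<times> 'a \<Rightarrow> (nat \<Rightarrow> real) \<Rightarrow> (nat \<Rightarrow> real) \<Rightarrow> real" where
  "weight_form e = quad_form (\<lambda>k l. W {fst e, snd e} $$ (k, l)) {..<s}"

text \<open>
  Summation by parts. The form is first a sum over arcs of \<open>z(u) \<bullet> W (z(u) - z(w))\<close>; averaging it
  with its image under reversal of arcs gives the squares of the differences. The factor 2 is
  there because each edge is a pair of arcs.
\<close>

lemma lap_energy:
  "2 * quad_form lap (pverts T \<times> {..<s}) z z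
    = (\<Sum>(u, w)\<in>parcs T. weight_form (u, w) (\<lambda>l. z (u, l) - z (w, l)) (\<lambda>l. z (u, l) - z (w, l)))"
proof -
  let ?d = "\<lambda>u w l. z (u, l) - z (w, l)"
  let ?N = "\<lambda>u. {w. (u, w) \<in> parcs T}"
  let ?B = "\<lambda>u w. weight_form (u, w) (\<lambda>k. z (u, k)) (?d u w)"
  have fin: "finite (?N u)" for u
    by (rule finite_subset[OF _ finite_verts]) (use adj_verts in auto)
  have "quad_form lap (pverts T \<times> {..<s}) z z
      = (\<Sum>u\<in>pverts T. \<Sum>k<s. z (u, k) * (\<Sum>q \<in> pverts T \<times> {..<s}. lap (u, k) q * z q))"
  proof -
    have pairs: "(\<Sum>p \<in> pverts T \<times> {..<s}. h p) = (\<Sum>u\<in>pverts T. \<Sum>k<s. h (u, k))"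
      for h :: "'a \<times> nat \<Rightarrow> real"
      by (simp add: sum.cartesian_product)
    have "quad_form lap (pverts T \<times> {..<s}) z z
        = (\<Sum>p \<in> pverts T \<times> {..<s}. z p * (\<Sum>q \<in> pverts T \<times> {..<s}. lap p q * z q))"
      by (simp add: quad_form_def sum_distrib_left mult.assoc)
    then show ?thesis by (simp only: pairs[of "\<lambda>p. z p * _ p"])
  qed
  also have "\<dots> = (\<Sum>u\<in>pverts T. \<Sum>k<s. \<Sum>w\<in>?N u. \<Sum>l<s. z (u, k) * W {u, w} $$ (k, l) * ?d u w l)"
    by (intro sum.cong refl) (simp add: lap_row sum_distrib_left mult.assoc)
  also have "\<dots> = (\<Sum>u\<in>pverts T. \<Sum>w\<in>?N u. ?B u w)"
    unfolding weight_form_def quad_form_def fst_conv snd_conv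
    by (rule sum.cong[OF refl], rule sum.swap)
  also have "\<dots> = (\<Sum>(u, w) \<in> (SIGMA u:pverts T. ?N u). ?B u w)"
    by (rule sum.Sigma) (use fin finite_verts in auto)
  also have "(SIGMA u:pverts T. ?N u) = parcs T" using adj_verts by auto
  finally have Q: "quad_form lap (pverts T \<times> {..<s}) z z = (\<Sum>(u, w)\<in>parcs T. ?B u w)" .
  have "(\<Sum>(u, w)\<in>parcs T. ?B u w) = (\<Sum>(u, w)\<in>parcs T. ?B w u)"
    by (rule sum.reindex_bij_witness[of _ prod.swap prod.swap]) (auto simp: adj_sym)
  then have "2 * quad_form lap (pverts T \<times> {..<s}) z z = (\<Sum>(u, w)\<in>parcs T. ?B u w + ?B w u)"
    using Q by (simp add: sum.distrib case_prod_beta)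
  also have "\<dots> = (\<Sum>(u, w)\<in>parcs T. weight_form (u, w) (?d u w) (?d u w))"
  proof -
    have "weight_form (w, u) = weight_form (u, w)" for u w
      by (simp add: weight_form_def insert_commute)
    then have "?B u w + ?B w u = weight_form (u, w) (?d u w) (?d u w)" for u w
      by (simp add: weight_form_def quad_form_polarize)
    then show ?thesis by (simp only:)
  qed
  finally show ?thesis .
qed

lemma weight_form_pos:
  assumes "(u, w) \<in> parcs T" "\<exists>l<s. f l \<noteq> 0"
  shows "0 < weight_form (u, w) f f"
  using pos_def_mat_imp_pos_def_on[OF weight_pos_def[OF assms(1)]] assms(2)
  unfolding pos_def_on_def weight_form_def by auto

text \<open>
  A vector of zero energy is constant along edges, hence constant on the tree, hence zero if it
  vanishes at \<open>x\<close>.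
\<close>

lemma lap_pos_def:
  assumes x: "x \<in> pverts T" and S: "S \<subseteq> pverts T - {x}"
  shows "pos_def_on lap (S \<times> {..<s})"
  unfolding pos_def_on_def
proof (intro allI impI)
  fix f :: "'a \<times> nat \<Rightarrow> real" assume nz: "\<exists>p\<in>S \<times> {..<s}. f p \<noteq> 0"
  let ?J = "S \<times> {..<s}" and ?V = "pverts T \<times> {..<s}"
  define z where "z = (\<lambda>p. if p \<in> ?J then f p else 0)"
  let ?e = "\<lambda>u w. weight_form (u, w) (\<lambda>l. z (u, l) - z (w, l)) (\<lambda>l. z (u, l) - z (w, l))"
  have sub: "?J \<subseteq> ?V" "finite ?V" using S finite_verts by auto
  have Q: "quad_form lap ?V z z = quad_form lap ?J f f"
    unfolding z_def by (rule quad_form_extend_by_zero[OF sub(2,1)])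
  have e_pos: "0 < ?e u w" if "(u, w) \<in> parcs T" "l < s" "z (u, l) \<noteq> z (w, l)" for u w l
    by (rule weight_form_pos[OF that(1)]) (use that in auto)
  have e_nonneg: "0 \<le> ?e u w" if "(u, w) \<in> parcs T" for u w
  proof (cases "\<exists>l<s. z (u, l) \<noteq> z (w, l)")
    case True
    then show ?thesis using e_pos[OF that] by fastforce
  next
    case False
    then show ?thesis by (simp add: weight_form_def quad_form_def)
  qed
  obtain u l where ul: "u \<in> S" "l < s" "z (u, l) \<noteq> 0" using nz by (auto simp: z_def)
  have "\<exists>(a, b)\<in>parcs T. z (a, l) \<noteq> z (b, l)"
  proof (rule ccontr)
    assume const: "\<not> (\<exists>(a, b)\<in>parcs T. z (a, l) \<noteq> z (b, l))"
    have "(u, x) \<in> (parcs T)\<^sup>*" using tree_connected ul(1) S x by auto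
    then have "z (u, l) = z (x, l)"
      by (induction rule: rtrancl_induct) (use const in auto)
    moreover have "x \<notin> S" using S by blast
    ultimately show False using ul(3) by (simp add: z_def)
  qed
  then obtain a b where ab: "(a, b) \<in> parcs T" "z (a, l) \<noteq> z (b, l)" by blast
  have "0 < (\<Sum>(u, w)\<in>parcs T. ?e u w)"
  proof (rule sum_pos2[of _ "(a, b)"])
    show "finite (parcs T)" by (rule pair_finite_arcs)
    show "0 < (case (a, b) of (u, w) \<Rightarrow> ?e u w)" using e_pos[OF ab(1) ul(2) ab(2)] by simp
    show "0 \<le> (case e of (u, w) \<Rightarrow> ?e u w)" if "e \<in> parcs T" for e
      using e_nonneg that by (cases e) auto
  qed (use ab in auto)
  then show "0 < quad_form lap ?J f f" using lap_energy[of z] Q by simp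
qed

text \<open>
  Let \<open>B\<close> be the branch at \<open>a\<close> containing \<open>w\<close>. Since \<open>f\<close> vanishes at \<open>a\<close>, the part \<open>y\<close> of \<open>f\<close> on \<open>B\<close> is
  not coupled to the rest and is itself extremal. Row \<open>a\<close> of its eigenvalue equation has a single
  contribution, \<open>W(a,w) f(w)\<close>, because \<open>w\<close> is the only neighbour of \<open>a\<close> in \<open>B\<close>.
\<close>

lemma extremal_zero_propagates:
  fixes \<mu> :: real
  assumes S: "S \<subseteq> pverts T" and opt: "optimal_bound lap (S \<times> {..<s}) \<mu>"
    and extremal: "(\<Sum>p\<in>S \<times> {..<s}. (f p)\<^sup>2) = \<mu> * quad_form lap (S \<times> {..<s}) f f"
    and a: "a \<in> S" "\<And>k. k < s \<Longrightarrow> f (a, k) = 0"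
    and w: "w \<in> S" "(a, w) \<in> parcs T"
    and l: "l < s"
  shows "f (w, l) = 0"
proof (rule ccontr)
  assume "f (w, l) \<noteq> 0"
  let ?J = "S \<times> {..<s}"
  have fin: "finite ?J" using finite_subset[OF S finite_verts] by simp
  obtain B where B: "B \<in> branches T a" "w \<in> B"
    using branch_cover[of w a] adj_verts[OF w(2)] by blast
  then have "a \<notin> B" by (auto simp: in_branches_iff)
  let ?D = "B \<times> UNIV :: ('a \<times> nat) set"
  define y where "y = (\<lambda>p. if p \<in> ?J \<inter> ?D then f p else 0)"
  have sep: "lap p q * f q = 0" if pq: "p \<in> ?J" "p \<in> ?D" "q \<in> ?J" "q \<notin> ?D" for p q
  proof (cases "fst q = a")
    case True
    then show ?thesis using a(2) pq(3) by (cases q) auto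
  next
    case False
    then have "lap p q = 0" by (intro lap_off_branch[OF B(1)]) (use pq in auto)
    then show ?thesis by simp
  qed
  have "(\<Sum>p\<in>?J \<inter> ?D. (f p)\<^sup>2) = \<mu> * quad_form lap (?J \<inter> ?D) f f"
    by (rule extremal_restrict[OF fin _ opt extremal]) (use sep lap_symmetric in auto)
  then have ext_y: "(\<Sum>p\<in>?J. (y p)\<^sup>2) = \<mu> * quad_form lap ?J y y"
    unfolding y_def sum_squares_extend_by_zero[OF fin Int_lower1] quad_form_extend_by_zero[OF fin Int_lower1] .
  have zero: "(\<Sum>l<s. W {a, w} $$ (k, l) * f (w, l)) = 0" if k: "k < s" for k
  proof -
    have "\<mu> * (\<Sum>q\<in>?J. lap (a, k) q * y q) = y (a, k)"
      by (rule extremal_imp_eigen[OF fin _ opt ext_y]) (use lap_symmetric a(1) k in auto)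
    also have "y (a, k) = 0" using \<open>a \<notin> B\<close> by (simp add: y_def)
    finally have "0 = (\<Sum>q\<in>?J. lap (a, k) q * y q)" using optimal_bound_pos[OF opt] by simp
    also have "\<dots> = (\<Sum>q\<in>{w} \<times> {..<s}. lap (a, k) q * y q)"
    proof (rule sum.mono_neutral_right[OF fin])
      show "{w} \<times> {..<s} \<subseteq> ?J" using w(1) by auto
      show "\<forall>q\<in>?J - {w} \<times> {..<s}. lap (a, k) q * y q = 0"
      proof
        fix q assume q: "q \<in> ?J - {w} \<times> {..<s}"
        show "lap (a, k) q * y q = 0"
        proof (cases "fst q \<in> B")
          case True
          then have "(a, fst q) \<notin> parcs T"
            using branch_unique_neighbour[OF B(1) _ B(2) _ w(2)] q by auto
          moreover have "a \<noteq> fst q" using True \<open>a \<notin> B\<close> by blast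
          ultimately have "lap (a, k) (fst q, snd q) = 0"
            using q k by (intro lap_nonadjacent) auto
          then show ?thesis by simp
        next
          case False
          then show ?thesis by (auto simp: y_def)
        qed
      qed
    qed
    also have "\<dots> = (\<Sum>l<s. lap (a, k) (w, l) * y (w, l))"
      by (rule sum.reindex_bij_witness[of _ "\<lambda>l. (w, l)" snd]) auto
    also have "\<dots> = - (\<Sum>l<s. W {a, w} $$ (k, l) * f (w, l))"
      unfolding sum_negf[symmetric]
      by (rule sum.cong) (use w B(2) k in \<open>auto simp: lap_adjacent y_def\<close>)
    finally show ?thesis by simp
  qed
  then have "weight_form (a, w) (\<lambda>l. f (w, l)) (\<lambda>l. f (w, l)) = 0"
    by (simp add: weight_form_def quad_form_def mult.assoc sum_distrib_left[symmetric])
  then show False using weight_form_pos[OF w(2), of "\<lambda>l. f (w, l)"] \<open>f (w, l) \<noteq> 0\<close> l by auto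
qed

end

section \<open>Perron branches\<close>

context weighted_tree
begin

text \<open>
  If the bounds were equal, an extremal vector on \<open>B\<close> would extend by zero to an extremal vector on
  \<open>C\<close>. It vanishes at \<open>v\<close>, and the zero spreads along walks through the connected set \<open>C\<close>.
\<close>

lemma optimal_bound_strict_mono:
  assumes C: "C \<in> branches T x" and B: "B \<subseteq> C" and v: "v \<in> C" "v \<notin> B" and x: "x \<in> pverts T"
    and optB: "optimal_bound lap (B \<times> {..<s}) \<beta>" and optC: "optimal_bound lap (C \<times> {..<s}) \<gamma>"
  shows "\<beta> < \<gamma>"
proof -
  let ?JB = "B \<times> {..<s}" and ?JC = "C \<times> {..<s}"
  have CV: "C \<subseteq> pverts T - {x}" using C by (simp add: in_branches_iff)
  have sub: "?JB \<subseteq> ?JC" using B by auto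
  have fin: "finite ?JC" using finite_subset[OF CV] finite_verts by simp
  have "\<beta> \<le> \<gamma>"
    by (rule optimal_bound_mono[OF optB optC sub fin lap_pos_def[OF x CV]])
  moreover have "\<beta> \<noteq> \<gamma>"
  proof
    assume "\<beta> = \<gamma>"
    obtain f where f: "\<exists>p\<in>?JB. f p \<noteq> 0" "(\<Sum>p\<in>?JB. (f p)\<^sup>2) = \<gamma> * quad_form lap ?JB f f"
      using optB \<open>\<beta> = \<gamma>\<close> by (auto simp: optimal_bound_def)
    define z where "z = (\<lambda>p. if p \<in> ?JB then f p else 0)"
    have ext: "(\<Sum>p\<in>?JC. (z p)\<^sup>2) = \<gamma> * quad_form lap ?JC z z"
      unfolding z_def sum_squares_extend_by_zero[OF fin sub] quad_form_extend_by_zero[OF fin sub]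
      by (rule f(2))
    have zero: "\<forall>k<s. z (u, k) = 0" if u: "u \<in> C" for u
    proof -
      have "(v, u) \<in> (parcs (pair_del_vert T x))\<^sup>*"
        using C v(1) u by (auto simp: in_branches_iff)
      then have "u \<in> C \<and> (\<forall>k<s. z (u, k) = 0)"
      proof (induction rule: rtrancl_induct)
        case base
        show ?case using v by (simp add: z_def)
      next
        case (step a w)
        have "w \<in> C" using branch_closed[OF C] step by auto
        moreover have "z (w, l) = 0" if "l < s" for l
          by (rule extremal_zero_propagates[OF _ optC ext _ _ \<open>w \<in> C\<close> _ that, of a])
            (use step CV in auto)
        ultimately show ?case by blast
      qed
      then show ?thesis by blast
    qed
    obtain u k where uk: "u \<in> B" "k < s" "f (u, k) \<noteq> 0" using f(1) by auto
    then have "z (u, k) = 0" using zero B by blast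
    then show False using uk by (simp add: z_def)
  qed
  ultimately show ?thesis by simp
qed

end

locale ordered_weighted_tree = weighted_tree T s W
  for T :: "'a pair_pre_digraph" and s :: nat and W :: "'a set \<Rightarrow> real mat" +
  fixes vs :: "'a list"
  assumes vs: "distinct vs" "set vs = pverts T"
begin

abbreviation radius :: "'a \<Rightarrow> real" where
  "radius x \<equiv> real_spectral_radius (bottleneck T s W vs x)"

abbreviation branch_radius :: "'a \<Rightarrow> 'a set \<Rightarrow> real" where
  "branch_radius x B \<equiv> real_spectral_radius (bottleneck_branch T s W vs x B)"

lemma laplacian_represents:
  "represents (laplacian T s W vs) (block_index s vs) (pverts T \<times> {..<s}) lap"
  using block_index_bij_betw[OF vs(1), of s]
  by (simp add: represents_def laplacian_def vs(2)) (simp add: block_index_def lap_def)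

lemma reduced_laplacian_represents:
  assumes "x \<in> pverts T"
  shows "represents (reduced_laplacian T s W vs x) (block_index s (filter (\<lambda>y. y \<noteq> x) vs))
    ((pverts T - {x}) \<times> {..<s}) lap"
  using represents_principal_blocks_delete[of _ s vs lap x] laplacian_represents assms vs
  by (simp add: reduced_laplacian_def)

lemma bottleneck_represents:
  assumes "x \<in> pverts T"
  obtains n where
    "represents (bottleneck T s W vs x) (block_index s (filter (\<lambda>y. y \<noteq> x) vs)) ((pverts T - {x}) \<times> {..<s}) n"
    "\<And>p r. p \<in> (pverts T - {x}) \<times> {..<s} \<Longrightarrow> r \<in> (pverts T - {x}) \<times> {..<s} \<Longrightarrow>
      (\<Sum>q\<in>(pverts T - {x}) \<times> {..<s}. lap p q * n q r) = (if p = r then 1 else 0)"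
proof -
  obtain N n where "mat_inverse (reduced_laplacian T s W vs x) = Some N"
    "represents N (block_index s (filter (\<lambda>y. y \<noteq> x) vs)) ((pverts T - {x}) \<times> {..<s}) n"
    "\<And>p r. p \<in> (pverts T - {x}) \<times> {..<s} \<Longrightarrow> r \<in> (pverts T - {x}) \<times> {..<s} \<Longrightarrow>
      (\<Sum>q\<in>(pverts T - {x}) \<times> {..<s}. lap p q * n q r) = (if p = r then 1 else 0)"
    using represents_inverse_exists[OF reduced_laplacian_represents[OF assms] lap_pos_def[OF assms order.refl]]
    by blast
  then show thesis using that[of n] by (simp add: bottleneck_def)
qed

lemma optimal_bound_radius:
  assumes x: "x \<in> pverts T" and ne: "pverts T - {x} \<noteq> {}"
  shows "optimal_bound lap ((pverts T - {x}) \<times> {..<s}) (radius x)"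
proof -
  obtain n where n:
    "represents (bottleneck T s W vs x) (block_index s (filter (\<lambda>y. y \<noteq> x) vs)) ((pverts T - {x}) \<times> {..<s}) n"
    "\<And>p r. p \<in> (pverts T - {x}) \<times> {..<s} \<Longrightarrow> r \<in> (pverts T - {x}) \<times> {..<s} \<Longrightarrow>
      (\<Sum>q\<in>(pverts T - {x}) \<times> {..<s}. lap p q * n q r) = (if p = r then 1 else 0)"
    using bottleneck_represents[OF x] by blast
  show ?thesis
  proof (rule spectral_radius_of_inverse[OF _ _ _ lap_pos_def[OF x order.refl] n(2,1)])
    show "(pverts T - {x}) \<times> {..<s} \<noteq> {}" using ne s_pos by (auto simp: lessThan_empty_iff)
  qed (use finite_verts lap_symmetric in auto)
qed

text \<open>
  Restricting the equation \<open>L N = 1\<close> at \<open>x\<close> to the rows and columns of \<open>B\<close> loses nothing, because the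
  rows of \<open>L\<close> in \<open>B\<close> have no entries in the other branches. So the diagonal block of \<open>N\<close> inverts
  the diagonal block of \<open>L\<close>.
\<close>

lemma optimal_bound_branch_radius:
  assumes x: "x \<in> pverts T" and B: "B \<in> branches T x"
  shows "optimal_bound lap (B \<times> {..<s}) (branch_radius x B)"
proof -
  let ?V = "(pverts T - {x}) \<times> {..<s}" and ?J = "B \<times> {..<s}"
  have BV: "B \<subseteq> pverts T - {x}" "B \<noteq> {}" using B by (auto simp: in_branches_iff)
  obtain n where n:
    "represents (bottleneck T s W vs x) (block_index s (filter (\<lambda>y. y \<noteq> x) vs)) ?V n"
    "\<And>p r. p \<in> ?V \<Longrightarrow> r \<in> ?V \<Longrightarrow> (\<Sum>q\<in>?V. lap p q * n q r) = (if p = r then 1 else 0)"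
    using bottleneck_represents[OF x] by blast
  have set: "set (filter (\<lambda>y. y \<noteq> x) vs) = pverts T - {x}" using vs by auto
  have "(pverts T - {x}) \<inter> B = B" using BV by blast
  then have "\<exists>e. represents (bottleneck_branch T s W vs x B) e ?J n"
    using represents_principal_blocks_pick[of "bottleneck T s W vs x" s "filter (\<lambda>y. y \<noteq> x) vs" n B] n(1) vs(1)
    unfolding set bottleneck_branch_def by auto
  then obtain e where rep: "represents (bottleneck_branch T s W vs x B) e ?J n" ..
  have sub: "?J \<subseteq> ?V" and fin: "finite ?V" using BV finite_verts by auto
  have inverse: "(\<Sum>q\<in>?J. lap p q * n q r) = (if p = r then 1 else 0)" if pr: "p \<in> ?J" "r \<in> ?J" for p r
  proof -
    have "lap p q * n q r = 0" if q: "q \<in> ?V - ?J" for q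
    proof -
      have "lap p q = 0" by (rule lap_off_branch[OF B]) (use pr q in auto)
      then show ?thesis by simp
    qed
    then have "(\<Sum>q\<in>?J. lap p q * n q r) = (\<Sum>q\<in>?V. lap p q * n q r)"
      by (intro sum.mono_neutral_left fin sub ballI)
    also have "\<dots> = (if p = r then 1 else 0)" using n(2)[of p r] pr sub by blast
    finally show ?thesis .
  qed
  show ?thesis
  proof (rule spectral_radius_of_inverse[OF _ _ _ lap_pos_def[OF x BV(1)] inverse rep])
    show "finite ?J" by (rule finite_subset[OF sub fin])
    show "?J \<noteq> {}" using BV(2) s_pos by (auto simp: lessThan_empty_iff)
  qed (use lap_symmetric in auto)
qed

lemma perron_branches_iff:
  "B \<in> perron_branches T s W vs x \<longleftrightarrow> B \<in> branches T x \<and> branch_radius x B = radius x"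
  by (simp add: perron_branches_def)

text \<open>
  A set of vertices that misses \<open>v\<close> is contained in \<open>V - {v}\<close>. For \<open>v \<noteq> x\<close> this compares bottleneck
  matrices at different vertices; for \<open>v = x\<close> it bounds a branch by the whole.
\<close>

lemma branch_radius_le:
  assumes x: "x \<in> pverts T" and B: "B \<in> branches T x"
    and v: "v \<in> pverts T" "v \<notin> B"
  shows "branch_radius x B \<le> radius v"
proof (rule optimal_bound_mono[OF optimal_bound_branch_radius[OF x B] optimal_bound_radius])
  have BV: "B \<subseteq> pverts T - {v}" "B \<noteq> {}" using B v by (auto simp: in_branches_iff)
  then show "pverts T - {v} \<noteq> {}" by blast
  show "B \<times> {..<s} \<subseteq> (pverts T - {v}) \<times> {..<s}" using BV by auto
  show "pos_def_on lap ((pverts T - {v}) \<times> {..<s})" by (rule lap_pos_def[OF v(1) order.refl])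
qed (use v finite_verts in auto)

text \<open>
  An extremal vector for \<open>V - {x}\<close> is nonzero on some branch, and its restriction to that branch
  is extremal with the same constant.
\<close>

lemma perron_branch_exists:
  assumes x: "x \<in> pverts T" and ne: "pverts T - {x} \<noteq> {}"
  shows "perron_branches T s W vs x \<noteq> {}"
proof -
  let ?J = "(pverts T - {x}) \<times> {..<s}"
  note opt = optimal_bound_radius[OF x ne]
  have fin: "finite ?J" using finite_verts by simp
  obtain f where f: "\<exists>p\<in>?J. f p \<noteq> 0" "(\<Sum>p\<in>?J. (f p)\<^sup>2) = radius x * quad_form lap ?J f f"
    using opt by (auto simp: optimal_bound_def)
  then obtain u k where u: "u \<in> pverts T" "u \<noteq> x" "k < s" "f (u, k) \<noteq> 0" by auto
  obtain B where B: "B \<in> branches T x" "u \<in> B" using branch_cover[OF u(1,2)] by blast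
  have BV: "B \<subseteq> pverts T - {x}" using B(1) by (simp add: in_branches_iff)
  have sep: "lap p q * f q = 0" if pq: "p \<in> ?J" "p \<in> B \<times> UNIV" "q \<in> ?J" "q \<notin> B \<times> UNIV" for p q
  proof -
    have "lap p q = 0" by (rule lap_off_branch[OF B(1)]) (use pq in auto)
    then show ?thesis by simp
  qed
  have "(\<Sum>p\<in>?J \<inter> B \<times> UNIV. (f p)\<^sup>2) = radius x * quad_form lap (?J \<inter> B \<times> UNIV) f f"
    by (rule extremal_restrict[OF fin _ opt f(2)]) (use sep lap_symmetric in auto)
  moreover have "?J \<inter> B \<times> UNIV = B \<times> {..<s}" using BV by auto
  ultimately have "(\<Sum>p\<in>B \<times> {..<s}. (f p)\<^sup>2) = radius x * quad_form lap (B \<times> {..<s}) f f" by simp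
  then have "radius x \<le> branch_radius x B"
    by (intro optimal_bound_le[OF optimal_bound_branch_radius[OF x B(1)] lap_pos_def[OF x BV]])
      (use u B(2) in auto)
  moreover have "branch_radius x B \<le> radius x"
    by (rule branch_radius_le[OF x B(1) x]) (use BV in auto)
  ultimately show ?thesis using B(1) by (auto simp: perron_branches_iff)
qed

text \<open>
  The comparison is \<open>radius v < radius x\<close>: the constant of \<open>B\<close> equals \<open>radius v\<close> and is strictly
  below that of \<open>C\<close>. Branches at \<open>x\<close> other than \<open>C\<close> miss \<open>v\<close> and stay at or below \<open>radius v\<close>. Having
  two Perron branches at \<open>v\<close> serves to choose \<open>B\<close> away from \<open>x\<close>.
\<close>

lemma perron_branch_off_characteristic_vertex:
  assumes v: "v \<in> pverts T" and two: "2 \<le> card (perron_branches T s W vs v)"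
    and x: "x \<in> pverts T" "x \<noteq> v"
  shows "\<exists>C. perron_branches T s W vs x = {C} \<and> v \<in> C"
proof -
  obtain B1 B2 where B12: "B1 \<in> perron_branches T s W vs v" "B2 \<in> perron_branches T s W vs v" "B1 \<noteq> B2"
    using two by (auto simp: numeral_2_eq_2 card_le_Suc_iff)
  obtain B where B: "B \<in> branches T v" "branch_radius v B = radius v" "x \<notin> B"
    using B12 branch_disjoint[of B1 v B2 x] by (auto simp: perron_branches_iff)
  obtain C where C: "C \<in> branches T x" "v \<in> C" using branch_cover[OF v] x(2) by metis
  have "v \<notin> B" using B(1) by (auto simp: in_branches_iff)
  have "branch_radius v B < branch_radius x C"
    by (rule optimal_bound_strict_mono[OF C(1) branch_subset_opposite_branch[OF B(1,3) C]
          C(2) \<open>v \<notin> B\<close> x(1) optimal_bound_branch_radius[OF v B(1)] optimal_bound_branch_radius[OF x(1) C(1)]])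
  also have "\<dots> \<le> radius x"
    by (rule branch_radius_le[OF x(1) C(1) x(1)]) (use C in \<open>auto simp: in_branches_iff\<close>)
  finally have less: "radius v < radius x" using B(2) by simp
  have "D = C" if D: "D \<in> perron_branches T s W vs x" for D
  proof (rule ccontr)
    assume "D \<noteq> C"
    have D': "D \<in> branches T x" "branch_radius x D = radius x" using D by (auto simp: perron_branches_iff)
    then have "v \<notin> D" using branch_disjoint[OF D'(1) C(1)] C(2) \<open>D \<noteq> C\<close> by blast
    then show False using branch_radius_le[OF x(1) D'(1) v] D'(2) less by simp
  qed
  moreover have "perron_branches T s W vs x \<noteq> {}"
    using perron_branch_exists[OF x(1)] v x(2) by blast
  ultimately show ?thesis using C(2) by blast
qed

end

theorem theorem3p7:
  fixes T :: "'a pair_pre_digraph" and s :: nat and W :: "'a set \<Rightarrow> real mat"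
    and vs :: "'a list" and v :: 'a
  assumes "undirected_tree T"
    and "1 \<le> s"
    and "\<And>u w. (u, w) \<in> parcs T \<Longrightarrow> pos_def_mat s (W {u, w})"
    and "distinct vs" and "set vs = pverts T"
    and "v \<in> pverts T"
    and "2 \<le> card (perron_branches T s W vs v)"
  shows "(\<forall>x \<in> pverts T. 2 \<le> card (perron_branches T s W vs x) \<longrightarrow> x = v) \<and>
         (\<forall>x \<in> pverts T. x \<noteq> v \<longrightarrow> (\<exists>B. perron_branches T s W vs x = {B} \<and> v \<in> B))"
proof -
  interpret ordered_weighted_tree T s W vs
    by unfold_locales (use assms in auto)
  have unique: "\<exists>B. perron_branches T s W vs x = {B} \<and> v \<in> B" if "x \<in> pverts T" "x \<noteq> v" for x
    by (rule perron_branch_off_characteristic_vertex[OF assms(6,7) that])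
  show ?thesis
  proof (intro conjI ballI impI)
    fix x assume "x \<in> pverts T" "2 \<le> card (perron_branches T s W vs x)"
    then show "x = v" using unique[of x] by fastforce
  qed (rule unique)
qed

end
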